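(* Let $a,b,\kappa,\mu\in\mathbb{R}$, $\alpha,\beta\ge0$, let $m$ be a positive integer, let $I=[0,T]$ with $T>0$, and let $t_0\in I$. Let $v$ be a weak solution of the generalized Rosenau-Kawahara-RLW equation $$v_t+a v_x+b v^m v_x+\kappa v_{xxx}-\alpha v_{xxt}+\beta v_{xxxxt}-\mu v_{xxxxx}=0$$ with initial data $v_0(x)=v(t_0,x)$ such that the equation is locally well-posed for $v_0$, in the sense that for some $s\ge 0$ one has $v_0\in H^s(\mathbb{R})$ and $v$ is the unique weak solution in $C(I,H^s(\mathbb{R}))$ whose value at $t=t_0$ is $v_0$. If $v$ is spatially symmetric with axis of symmetry $\lambda(t)$, then $v$ is a steady solution with speed $\dot\lambda(t_0)$, i.e. there is a function $g$ such that $v(t,x)=g(x-\dot\lambda(t_0)t)$ on $I\times\mathbb{R}$.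
   Context: Put $L:=1-\alpha\partial_x^2+\beta\partial_x^4$. A function $v\in C(I,L^2(\mathbb{R}))$ is called a weak solution of the equation if $$\iint_{I\times\mathbb{R}} \Big[ v\,L(\phi_t)+\Big(a v+\frac{b}{m+1}v^{m+1}\Big)\phi_x+\kappa v\,\phi_{xxx}-\mu v\,\phi_{xxxxx}\Big]\,\mathrm{d}t\,\mathrm{d}x=0$$ for all $\phi\in C_c^\infty(I\times\mathbb{R})$, where test functions are smooth with compact support in the open set given by the interior of $I\times\mathbb{R}$, and all terms are understood to be well defined (in particular $v^{m+1}$ is locally integrable). A function $f(t,x)$ on $I\times\mathbb{R}$ is spatially symmetric if there exists $\lambda\in C^1(\mathbb{R})$ (the axis of symmetry) such that $f(t,x)=f(t,2\lambda(t)-x)$ for every $(t,x)\in I\times\mathbb{R}$ (for weak solutions: for each $t\in I$, as elements of $L^2(\mathbb{R})$). A function $f$ is steady (traveling) with speed $c$ if $f(t,x)=g(x-ct)$ for some function $g$. A dot denotes the derivative in $t$. *)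

theory Defs
  imports "HOL-Analysis.Analysis"
begin

text \<open>
  Elements of \<open>L\<^sup>2(\<real>)\<close> are represented by Borel functions, and equality in \<open>L\<^sup>2(\<real>)\<close> is
  equality almost everywhere.
\<close>

definition L2 :: "(real \<Rightarrow> 'a::real_normed_vector) \<Rightarrow> bool" where
  "L2 f \<longleftrightarrow> f \<in> borel_measurable borel \<and> integrable lborel (\<lambda>x. (norm (f x))\<^sup>2)"

definition L2_norm :: "(real \<Rightarrow> 'a::real_normed_vector) \<Rightarrow> real" where
  "L2_norm f = sqrt (LINT x|lborel. (norm (f x))\<^sup>2)"

definition in_C_L2 :: "real set \<Rightarrow> (real \<Rightarrow> real \<Rightarrow> real) \<Rightarrow> bool" where
  "in_C_L2 I v \<longleftrightarrow>
     (\<forall>t\<in>I. L2 (v t)) \<and>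
     (\<forall>t\<in>I. ((\<lambda>r. L2_norm (\<lambda>x. v r x - v t x)) \<longlongrightarrow> 0) (at t within I))"

text \<open>
  The Fourier transform of \<open>f \<in> L\<^sup>2(\<real>)\<close> is the \<open>L\<^sup>2\<close>-limit of the transforms of its
  truncations to \<open>[-R, R]\<close>. By Plancherel's theorem it exists and is unique almost everywhere,
  so the choice below does not affect the Sobolev norms.
\<close>

definition is_fourier_L2 :: "(real \<Rightarrow> real) \<Rightarrow> (real \<Rightarrow> complex) \<Rightarrow> bool" where
  "is_fourier_L2 f F \<longleftrightarrow>
     L2 F \<and>
     ((\<lambda>R. \<integral>\<^sup>+ \<xi>. ennreal ((norm (F \<xi> - (LINT x:{-R..R}|lborel. cis (- (x * \<xi>)) * complex_of_real (f x))))\<^sup>2)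
        \<partial>lborel) \<longlongrightarrow> 0) at_top"

definition fourier_L2 :: "(real \<Rightarrow> real) \<Rightarrow> real \<Rightarrow> complex" where
  "fourier_L2 f = (SOME F. is_fourier_L2 f F)"

definition in_Hs :: "real \<Rightarrow> (real \<Rightarrow> real) \<Rightarrow> bool" where
  "in_Hs s f \<longleftrightarrow> L2 f \<and>
     integrable lborel (\<lambda>\<xi>. (1 + \<xi>\<^sup>2) powr s * (norm (fourier_L2 f \<xi>))\<^sup>2)"

definition Hs_norm :: "real \<Rightarrow> (real \<Rightarrow> real) \<Rightarrow> real" where
  "Hs_norm s f = sqrt (LINT \<xi>|lborel. (1 + \<xi>\<^sup>2) powr s * (norm (fourier_L2 f \<xi>))\<^sup>2)"

definition in_C_Hs :: "real set \<Rightarrow> real \<Rightarrow> (real \<Rightarrow> real \<Rightarrow> real) \<Rightarrow> bool" where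
  "in_C_Hs I s v \<longleftrightarrow>
     (\<forall>t\<in>I. in_Hs s (v t)) \<and>
     (\<forall>t\<in>I. ((\<lambda>r. Hs_norm s (\<lambda>x. v r x - v t x)) \<longlongrightarrow> 0) (at t within I))"

definition Dt :: "(real \<Rightarrow> real \<Rightarrow> real) \<Rightarrow> real \<Rightarrow> real \<Rightarrow> real" where
  "Dt \<phi> t x = deriv (\<lambda>r. \<phi> r x) t"

definition Dx :: "(real \<Rightarrow> real \<Rightarrow> real) \<Rightarrow> real \<Rightarrow> real \<Rightarrow> real" where
  "Dx \<phi> t x = deriv (\<lambda>y. \<phi> t y) x"

text \<open>All iterated partial derivatives of order at most \<open>k\<close>, in any order, exist and are continuous.\<close>

primrec Ck :: "nat \<Rightarrow> (real \<Rightarrow> real \<Rightarrow> real) \<Rightarrow> bool" where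
  "Ck 0 \<phi> \<longleftrightarrow> continuous_on UNIV (\<lambda>(t, x). \<phi> t x)"
| "Ck (Suc k) \<phi> \<longleftrightarrow>
     continuous_on UNIV (\<lambda>(t, x). \<phi> t x) \<and>
     (\<forall>t x. (\<lambda>r. \<phi> r x) differentiable (at t) \<and> (\<lambda>y. \<phi> t y) differentiable (at x)) \<and>
     Ck k (Dt \<phi>) \<and> Ck k (Dx \<phi>)"

text \<open>Test functions on the open set \<open>U\<close> are extended by zero to the whole plane.\<close>

definition test_function :: "(real \<times> real) set \<Rightarrow> (real \<Rightarrow> real \<Rightarrow> real) \<Rightarrow> bool" where
  "test_function U \<phi> \<longleftrightarrow>
     (\<forall>k. Ck k \<phi>) \<and>
     compact (closure {(t, x). \<phi> t x \<noteq> 0}) \<and> closure {(t, x). \<phi> t x \<noteq> 0} \<subseteq> U"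

definition locally_integrable_on :: "(real \<times> real) set \<Rightarrow> (real \<times> real \<Rightarrow> real) \<Rightarrow> bool" where
  "locally_integrable_on U f \<longleftrightarrow> (\<forall>K. compact K \<and> K \<subseteq> U \<longrightarrow> set_integrable lborel K f)"

definition opL :: "real \<Rightarrow> real \<Rightarrow> (real \<Rightarrow> real \<Rightarrow> real) \<Rightarrow> real \<Rightarrow> real \<Rightarrow> real" where
  "opL \<alpha> \<beta> \<psi> t x = \<psi> t x - \<alpha> * (Dx ^^ 2) \<psi> t x + \<beta> * (Dx ^^ 4) \<psi> t x"

text \<open>
  Joint measurability makes the double integral meaningful. It is no restriction on the curve
  \<open>t \<mapsto> v(t)\<close>: every element of \<open>C(I, L\<^sup>2(\<real>))\<close> has a jointly Borel representative which agrees
  with \<open>v(t)\<close> almost everywhere for every \<open>t \<in> I\<close>. Values of \<open>v t\<close> for \<open>t \<notin> I\<close> play no role.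
\<close>

definition weak_solution ::
  "real \<Rightarrow> real \<Rightarrow> real \<Rightarrow> real \<Rightarrow> real \<Rightarrow> real \<Rightarrow> nat \<Rightarrow> real set \<Rightarrow> (real \<Rightarrow> real \<Rightarrow> real) \<Rightarrow> bool" where
  "weak_solution a b \<kappa> \<alpha> \<beta> \<mu> m I v \<longleftrightarrow>
     in_C_L2 I v \<and>
     set_borel_measurable borel (I \<times> UNIV) (\<lambda>(t, x). v t x) \<and>
     locally_integrable_on (interior (I \<times> UNIV)) (\<lambda>(t, x). v t x ^ (m + 1)) \<and>
     (\<forall>\<phi>. test_function (interior (I \<times> UNIV)) \<phi> \<longrightarrow>
        set_lebesgue_integral lborel (I \<times> UNIV)
          (\<lambda>(t, x). v t x * opL \<alpha> \<beta> (Dt \<phi>) t x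
             + (a * v t x + b / (real m + 1) * v t x ^ (m + 1)) * Dx \<phi> t x
             + \<kappa> * v t x * (Dx ^^ 3) \<phi> t x
             - \<mu> * v t x * (Dx ^^ 5) \<phi> t x) = 0)"

definition well_posed_for ::
  "real \<Rightarrow> real \<Rightarrow> real \<Rightarrow> real \<Rightarrow> real \<Rightarrow> real \<Rightarrow> nat \<Rightarrow> real set \<Rightarrow> real \<Rightarrow> (real \<Rightarrow> real)
    \<Rightarrow> (real \<Rightarrow> real \<Rightarrow> real) \<Rightarrow> bool" where
  "well_posed_for a b \<kappa> \<alpha> \<beta> \<mu> m I t0 v0 v \<longleftrightarrow>
     (\<exists>s\<ge>0. in_Hs s v0 \<and>
        (let sol = (\<lambda>w. weak_solution a b \<kappa> \<alpha> \<beta> \<mu> m I w \<and> in_C_Hs I s w \<and>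
                        (AE x in lborel. w t0 x = v0 x))
         in sol v \<and> (\<forall>w. sol w \<longrightarrow> (\<forall>t\<in>I. AE x in lborel. w t x = v t x))))"

definition spatially_symmetric :: "real set \<Rightarrow> (real \<Rightarrow> real \<Rightarrow> real) \<Rightarrow> (real \<Rightarrow> real) \<Rightarrow> bool" where
  "spatially_symmetric I v lam \<longleftrightarrow>
     lam C1_differentiable_on UNIV \<and>
     (\<forall>t\<in>I. AE x in lborel. v t x = v t (2 * lam t - x))"

definition steady :: "real set \<Rightarrow> (real \<Rightarrow> real \<Rightarrow> real) \<Rightarrow> real \<Rightarrow> bool" where
  "steady I v c \<longleftrightarrow> (\<exists>g. \<forall>t\<in>I. AE x in lborel. v t x = g (x - c * t))"

end

theory Submission
  imports Defs
begin

text \<open>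
  Let \<open>\<lambda>\<close> be the axis of symmetry. By approximation, the weak formulation holds for test functions
  \<open>\<psi>(t) \<eta>(x - \<lambda>(t))\<close> although \<open>\<lambda>\<close> is only of class \<open>C\<^sup>1\<close>. If \<open>\<eta>\<close> is even, the symmetry of \<open>v\<close> removes
  all terms except the one containing \<open>\<psi>'\<close>, so \<open>L w\<close> does not depend on time for
  \<open>w(t,x) = v(t, x + \<lambda>(t))\<close>, and since \<open>L\<close> is injective on \<open>L\<^sup>2\<close>, \<open>w(t,x) = V(x)\<close>. If \<open>\<eta>\<close> is odd, the
  remaining terms say \<open>\<lambda>'(t) A = N\<close> with time-independent integrals \<open>A = \<integral> V L\<eta>'\<close> and \<open>N\<close>. Either
  \<open>A = 0\<close> for every \<open>\<eta>\<close>, whence \<open>V = 0\<close>, or \<open>\<lambda>'\<close> is constant.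
\<close>

section \<open>Smooth functions and bumps\<close>

text \<open>The weak formulation only sees smooth test functions, while the axis is C1 and
  \<open>v t\<close> is merely in L2. The identity obtained from \<psi>(t) \<eta>(x - \<gamma>(t))
  contains \<gamma> and \<gamma>' but no higher derivative, so it survives C1 approximation of
  \<gamma> by polynomials on {0..T}. The power v^(m+1) is known to be integrable only on compact
  subsets of the open strip, hence the limit is taken in plane integrals; symmetry, which holds for
  each t, is used after Fubini. Injectivity of L needs no Fourier transform: pairing f with the
  translates of a test function gives a smooth function of the translation, all of whose derivatives
  decay at both ends and which solves u - \<alpha> u'' + \<beta> u'''' = 0 classically. An energy
  argument applies, and this is where \<alpha>, \<beta> \<ge> 0 enter. For L d/dx there remains a
  constant, which decay makes 0. Test functions vanish near t = 0 and t = T. Continuity in t of the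
  pairings of v(t) with moving test functions, and of the derivative of the axis, carries the
  conclusions to the closed interval, so t0 may be an endpoint.\<close>

primrec diff_times :: "nat \<Rightarrow> (real \<Rightarrow> real) \<Rightarrow> bool" where
  "diff_times 0 f \<longleftrightarrow> True"
| "diff_times (Suc k) f \<longleftrightarrow> (\<exists>f'. (\<forall>x. (f has_real_derivative f' x) (at x)) \<and> diff_times k f')"

definition smooth :: "(real \<Rightarrow> real) \<Rightarrow> bool" where
  "smooth f \<longleftrightarrow> (\<forall>k. diff_times k f)"

lemma diff_times_SucD: "diff_times (Suc k) f \<Longrightarrow> diff_times k f"
proof (induction k arbitrary: f)
  case (Suc k)
  then show ?case by (metis diff_times.simps(2))
qed simp

text \<open>Spares a formula for the k-th derivative: by induction on k, membership in a class
  closed under differentiation is enough.\<close>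

lemma smooth_coinduct:
  assumes "X f"
    and "\<And>g. X g \<Longrightarrow> \<exists>g'. X g' \<and> (\<forall>x. (g has_real_derivative g' x) (at x))"
  shows "smooth f"
proof -
  have "X g \<Longrightarrow> diff_times k g" for k g
    by (induction k arbitrary: g) (use assms(2) in \<open>auto, blast\<close>)
  then show ?thesis using assms(1) by (simp add: smooth_def)
qed

lemma smooth_DERIV:
  assumes "smooth f"
  shows "(f has_real_derivative deriv f x) (at x)"
proof -
  have "diff_times (Suc 0) f" using assms by (simp add: smooth_def del: diff_times.simps)
  then obtain f' where "\<And>x. (f has_real_derivative f' x) (at x)" by auto
  then show ?thesis by (metis DERIV_imp_deriv)
qed

lemma smooth_deriv:
  assumes "smooth f"
  shows "smooth (deriv f)"
  unfolding smooth_def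
proof
  fix k
  have "diff_times (Suc k) f" using assms by (simp add: smooth_def del: diff_times.simps)
  then obtain f' where f': "\<forall>x. (f has_real_derivative f' x) (at x)" "diff_times k f'" by auto
  have "f' = deriv f" using f'(1) by (metis DERIV_imp_deriv ext)
  then show "diff_times k (deriv f)" using f'(2) by simp
qed

lemma smooth_funpow_deriv: "smooth f \<Longrightarrow> smooth ((deriv ^^ k) f)"
  by (induction k) (auto intro: smooth_deriv)

lemma smooth_continuous_on: "smooth f \<Longrightarrow> continuous_on S f"
  by (meson DERIV_isCont continuous_at_imp_continuous_on smooth_DERIV)

lemma smooth_const: "smooth (\<lambda>x. c)"
  by (rule smooth_coinduct[where X = "\<lambda>f. \<exists>c. f = (\<lambda>x. c)"]) (auto intro!: exI derivative_eq_intros)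

lemma diff_times_add: "diff_times k f \<Longrightarrow> diff_times k g \<Longrightarrow> diff_times k (\<lambda>x. f x + g x)"
proof (induction k arbitrary: f g)
  case (Suc k)
  then obtain f' g' where d: "\<forall>x. (f has_real_derivative f' x) (at x)" "diff_times k f'"
     "\<forall>x. (g has_real_derivative g' x) (at x)" "diff_times k g'" by auto
  then show ?case
    by (auto intro!: exI[of _ "\<lambda>x. f' x + g' x"] Suc.IH derivative_intros)
qed simp

lemma smooth_add: "smooth f \<Longrightarrow> smooth g \<Longrightarrow> smooth (\<lambda>x. f x + g x)"
  by (simp add: smooth_def diff_times_add)

lemma diff_times_mult: "diff_times k f \<Longrightarrow> diff_times k g \<Longrightarrow> diff_times k (\<lambda>x. f x * g x)"
proof (induction k arbitrary: f g)
  case (Suc k)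
  then obtain f' g' where d: "\<forall>x. (f has_real_derivative f' x) (at x)" "diff_times k f'"
     "\<forall>x. (g has_real_derivative g' x) (at x)" "diff_times k g'" by auto
  have "diff_times k f" "diff_times k g" using Suc.prems by (auto intro!: diff_times_SucD simp del: diff_times.simps)
  then have "diff_times k (\<lambda>x. f x * g' x + f' x * g x)"
    using d by (intro diff_times_add Suc.IH)
  with d show ?case
    by (auto intro!: exI[of _ "\<lambda>x. f x * g' x + f' x * g x"] derivative_eq_intros)
qed simp

lemma smooth_mult: "smooth f \<Longrightarrow> smooth g \<Longrightarrow> smooth (\<lambda>x. f x * g x)"
  by (simp add: smooth_def diff_times_mult)

lemma smooth_cmult: "smooth f \<Longrightarrow> smooth (\<lambda>x. c * f x)"
  by (intro smooth_mult smooth_const)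

lemma smooth_affine:
  assumes "smooth f"
  shows "smooth (\<lambda>x. f (c * x + d))"
\<comment> \<open>The factor \<open>e\<close> absorbs the powers of \<open>c\<close> that repeated
  use of the chain rule produces.\<close>
proof (rule smooth_coinduct[where X = "\<lambda>g. \<exists>f e. smooth f \<and> g = (\<lambda>x. e * f (c * x + d))"])
  show "\<exists>f' e. smooth f' \<and> (\<lambda>x. f (c * x + d)) = (\<lambda>x. e * f' (c * x + d))"
    by (rule exI[of _ f], rule exI[of _ 1]) (simp add: assms)
next
  fix g
  assume "\<exists>f e. smooth f \<and> g = (\<lambda>x. e * f (c * x + d))"
  then obtain f e where f: "smooth f" and g: "g = (\<lambda>x. e * f (c * x + d))" by auto
  have "(g has_real_derivative e * c * deriv f (c * x + d)) (at x)" for x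
    unfolding g by (auto intro!: derivative_eq_intros DERIV_chain2[OF smooth_DERIV[OF f]])
  then show "\<exists>g'. (\<exists>f e. smooth f \<and> g' = (\<lambda>x. e * f (c * x + d))) \<and>
      (\<forall>x. (g has_real_derivative g' x) (at x))"
    by (intro exI[of _ "\<lambda>x. (e * c) * deriv f (c * x + d)"])
       (use smooth_deriv[OF f] in auto)
qed

lemma smooth_real_polynomial_function:
  "real_polynomial_function p \<Longrightarrow> smooth p"
  by (rule smooth_coinduct[where X = real_polynomial_function])
     (auto elim!: has_real_derivative_polynomial_function)

text \<open>Serves to integrate a Weierstrass approximation of a derivative; the normalisation at 0
  lets the integrated curve start at the right point.\<close>

lemma real_polynomial_function_antiderivative:
  fixes p :: "real \<Rightarrow> real"
  assumes "real_polynomial_function p"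
  obtains q where "real_polynomial_function q" "q 0 = 0" "\<And>x. (q has_real_derivative p x) (at x)"
proof -
  obtain a n where p: "p = (\<lambda>x. \<Sum>i\<le>n. a i * x ^ i)"
    using assms real_polynomial_function_iff_sum by auto
  define q where "q = (\<lambda>x::real. \<Sum>i\<le>n. a i / real (Suc i) * x ^ Suc i)"
  show ?thesis
  proof
    show "real_polynomial_function q"
      unfolding q_def
      by (intro real_polynomial_function_sum real_polynomial_function_power
          real_polynomial_function.intros bounded_linear_ident) auto
    show "q 0 = 0" by (simp add: q_def)
    have "((\<lambda>x. a i / real (Suc i) * x ^ Suc i) has_real_derivative a i * x ^ i) (at x)" for i x
      by (rule derivative_eq_intros refl | simp)+
    then show "(q has_real_derivative p x) (at x)" for x
      unfolding q_def p by (intro DERIV_sum)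
  qed
qed

section \<open>The flat function exp(-1/x) and smooth bumps\<close>

definition flat :: "real \<Rightarrow> real" where
  "flat x = (if x > 0 then exp (- (1 / x)) else 0)"

lemma flat_nonneg: "0 \<le> flat x" and flat_le_1: "flat x \<le> 1"
  by (auto simp: flat_def)

lemma tendsto_poly_exp_at_right:
  fixes P :: "real poly"
  shows "((\<lambda>x. poly P (1 / x) * exp (- (1 / x))) \<longlongrightarrow> 0) (at_right 0)"
proof -
  have "((\<lambda>y::real. y ^ k * exp (- y)) \<longlongrightarrow> 0) at_top" for k
    using tendsto_power_div_exp_0[of k] by (simp add: exp_minus divide_inverse)
  then have "((\<lambda>y. \<Sum>i\<le>degree P. coeff P i * (y ^ i * exp (- y))) \<longlongrightarrow> 0) at_top"
    by (auto intro!: tendsto_null_sum tendsto_mult_right_zero)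
  then have "((\<lambda>y. poly P y * exp (- y)) \<longlongrightarrow> 0) at_top"
    by (simp add: poly_altdef sum_distrib_right mult.assoc)
  then have "((\<lambda>x. poly P (inverse x) * exp (- inverse x)) \<longlongrightarrow> 0) (at_right 0)"
    by (rule filterlim_compose[OF _ filterlim_inverse_at_top_right])
  then show ?thesis by (simp add: inverse_eq_divide)
qed

text \<open>With y = 1/x one has dy/dx = -y^2, so differentiating P(y) exp(-y) turns P into X^2 (P -
  P'). The functions of this shape, extended by 0, thus form a class closed under
  differentiation.\<close>

lemma DERIV_poly_exp_flat:
  fixes P :: "real poly"
  defines "g \<equiv> (\<lambda>(P::real poly) x. if x > 0 then poly P (1 / x) * exp (- (1 / x)) else 0)"
  shows "(g P has_real_derivative g ([:0, 0, 1:] * (P - pderiv P)) x) (at x)"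
proof (cases "x = 0")
  case True
  \<comment> \<open>For h > 0 the difference quotient at 0 is the function attached to X P; the
    exponential beats the additional factor 1/h.\<close>
  have r: "((\<lambda>h. poly ([:0, 1:] * P) (1 / h) * exp (- (1 / h))) \<longlongrightarrow> 0) (at_right (0::real))"
    by (rule tendsto_poly_exp_at_right)
  have "((\<lambda>h. g P h / h) \<longlongrightarrow> 0) (at 0)"
  proof (rule filterlim_split_at)
    show "((\<lambda>h. g P h / h) \<longlongrightarrow> 0) (at_left 0)"
      by (rule Lim_transform_eventually[OF tendsto_const])
         (auto simp: eventually_at_left_field g_def intro!: exI[of _ "-1"])
    show "((\<lambda>h. g P h / h) \<longlongrightarrow> 0) (at_right 0)"
      by (rule Lim_transform_eventually[OF r])
         (auto simp: eventually_at_right_field g_def intro!: exI[of _ 1])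
  qed
  then have "((\<lambda>h. (g P (0 + h) - g P 0) / h) \<longlongrightarrow> 0) (at 0)"
    by (simp only: add_0_left) (simp add: g_def)
  then have "(g P has_real_derivative 0) (at 0)" by (simp only: DERIV_def)
  then show ?thesis using True by (simp add: g_def)
next
  case False
  show ?thesis
  proof (cases "x > 0")
    case True
    have "((\<lambda>x. poly P (1 / x) * exp (- (1 / x))) has_real_derivative
        poly ([:0, 0, 1:] * (P - pderiv P)) (1 / x) * exp (- (1 / x))) (at x)"
      using True
      by (auto intro!: derivative_eq_intros DERIV_chain2[OF poly_DERIV] simp: field_simps power2_eq_square)
    then have "((\<lambda>x. poly P (1 / x) * exp (- (1 / x))) has_real_derivative
        g ([:0, 0, 1:] * (P - pderiv P)) x) (at x)"
      using True by (simp add: g_def)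
    then show ?thesis
      by (rule has_field_derivative_transform_within_open[where S = "{0<..}"])
         (use True in \<open>auto simp: g_def\<close>)
  next
    case neg: False
    have "((\<lambda>x. 0) has_real_derivative g ([:0, 0, 1:] * (P - pderiv P)) x) (at x)"
      using neg by (simp add: g_def)
    then show ?thesis
      by (rule has_field_derivative_transform_within_open[where S = "{..<0}"])
         (use neg False in \<open>auto simp: g_def\<close>)
  qed
qed

lemma smooth_flat: "smooth flat"
proof (rule smooth_coinduct[where
      X = "\<lambda>g. \<exists>P::real poly. g = (\<lambda>x. if x > 0 then poly P (1 / x) * exp (- (1 / x)) else 0)"])
  show "\<exists>P::real poly. flat = (\<lambda>x. if x > 0 then poly P (1 / x) * exp (- (1 / x)) else 0)"
    by (rule exI[of _ 1]) (auto simp: flat_def)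
qed (use DERIV_poly_exp_flat in blast)

text \<open>The exponent tends to \<open>0\<close> as \<open>n \<rightarrow> \<infinity>\<close>, so these bumps converge to the indicator of \<open>{p<..<q}\<close>.\<close>

definition bump :: "nat \<Rightarrow> real \<Rightarrow> real \<Rightarrow> real \<Rightarrow> real" where
  "bump n p q x = flat (real n * (x - p)) * flat (real n * (q - x))"

lemma smooth_bump: "smooth (bump n p q)"
proof -
  have "smooth (\<lambda>x. flat (real n * x + - real n * p) * flat (- real n * x + real n * q))"
    by (intro smooth_mult smooth_affine smooth_flat)
  moreover have "bump n p q = (\<lambda>x. flat (real n * x + - real n * p) * flat (- real n * x + real n * q))"
    by (auto simp: bump_def algebra_simps)
  ultimately show ?thesis by simp
qed

lemma bump_eq_0: "x \<notin> {p..q} \<Longrightarrow> bump n p q x = 0"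
  by (auto simp: bump_def flat_def zero_less_mult_iff)

lemma bump_le_1: "\<bar>bump n p q x\<bar> \<le> 1"
  by (auto simp: bump_def abs_mult flat_nonneg flat_le_1 intro!: mult_le_one)

lemma flat_mult_tendsto:
  assumes "y > 0"
  shows "(\<lambda>n. flat (real n * y)) \<longlonglongrightarrow> 1"
proof -
  have "(\<lambda>n. exp (- (1 / y * inverse (real n)))) \<longlonglongrightarrow> exp (- (1 / y * 0))"
    by (intro tendsto_intros lim_inverse_n)
  then have "(\<lambda>n. exp (- (1 / y * inverse (real n)))) \<longlonglongrightarrow> 1" by simp
  then show ?thesis
  proof (rule Lim_transform_eventually)
    show "\<forall>\<^sub>F n in sequentially. exp (- (1 / y * inverse (real n))) = flat (real n * y)"
      using eventually_gt_at_top[of 0]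
      by eventually_elim (use assms in \<open>auto simp: flat_def field_simps\<close>)
  qed
qed

lemma bump_tendsto: "(\<lambda>n. bump n p q x) \<longlonglongrightarrow> indicator {p<..<q} x"
proof (cases "x \<in> {p<..<q}")
  case True
  have "(\<lambda>n. flat (real n * (x - p)) * flat (real n * (q - x))) \<longlonglongrightarrow> 1 * 1"
    using True by (intro tendsto_mult flat_mult_tendsto) auto
  then show ?thesis using True by (simp add: bump_def)
next
  case False
  then have "bump n p q x = 0" for n
    by (auto simp: bump_def flat_def zero_less_mult_iff)
  then show ?thesis using False by simp
qed

section \<open>Compactly supported smooth functions and the fundamental lemma\<close>

lemma deriv_add_cmult:
  assumes "smooth f" "smooth g"
  shows "deriv (\<lambda>x. f x + c * g x) = (\<lambda>x. deriv f x + c * deriv g x)"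
  by (rule ext, rule DERIV_imp_deriv)
     (intro DERIV_add DERIV_cmult smooth_DERIV assms)

lemma funpow_deriv_add_cmult:
  assumes "smooth f" "smooth g"
  shows "(deriv ^^ k) (\<lambda>x. f x + c * g x) = (\<lambda>x. (deriv ^^ k) f x + c * (deriv ^^ k) g x)"
  by (induction k) (auto simp: deriv_add_cmult smooth_funpow_deriv assms)

lemma funpow_deriv_affine:
  assumes "smooth f"
  shows "(deriv ^^ k) (\<lambda>x. f (c * x + d)) = (\<lambda>x. c ^ k * (deriv ^^ k) f (c * x + d))"
proof (induction k)
  case (Suc k)
  have "deriv (\<lambda>x. c ^ k * (deriv ^^ k) f (c * x + d)) x = c ^ k * (c * deriv ((deriv ^^ k) f) (c * x + d))" for x
    by (rule DERIV_imp_deriv)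
       (auto intro!: derivative_eq_intros DERIV_chain2[OF smooth_DERIV[OF smooth_funpow_deriv[OF assms]]])
  then show ?case using Suc by (auto simp: mult_ac)
qed simp

text \<open>The interval is an explicit parameter: time factors must stay in a compact part of the
  open time interval, and space factors need an interval symmetric about 0 in order to be
  reflected.\<close>

definition smooth_supp :: "real \<Rightarrow> real \<Rightarrow> (real \<Rightarrow> real) \<Rightarrow> bool" where
  "smooth_supp p q f \<longleftrightarrow> smooth f \<and> (\<forall>x. x \<notin> {p..q} \<longrightarrow> f x = 0)"

lemma smooth_supp_smooth: "smooth_supp p q f \<Longrightarrow> smooth f"
  by (simp add: smooth_supp_def)

lemma smooth_supp_mono: "smooth_supp p q f \<Longrightarrow> p' \<le> p \<Longrightarrow> q \<le> q' \<Longrightarrow> smooth_supp p' q' f"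
  by (auto simp: smooth_supp_def)

lemma smooth_supp_bump: "p' \<le> p \<Longrightarrow> q \<le> q' \<Longrightarrow> smooth_supp p' q' (bump n p q)"
  by (auto simp: smooth_supp_def smooth_bump bump_eq_0)

lemma smooth_supp_deriv:
  assumes "smooth_supp p q f"
  shows "smooth_supp p q (deriv f)"
  unfolding smooth_supp_def
proof (intro conjI allI impI)
  show "smooth (deriv f)" using assms by (simp add: smooth_supp_def smooth_deriv)
next
  fix x assume x: "x \<notin> {p..q}"
  have "((\<lambda>x. 0) has_real_derivative 0) (at x)" by simp
  then have "(f has_real_derivative 0) (at x)"
    by (rule has_field_derivative_transform_within_open[where S = "- {p..q}"])
       (use x assms in \<open>auto simp: smooth_supp_def open_Compl\<close>)
  then show "deriv f x = 0" by (rule DERIV_imp_deriv)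
qed

lemma smooth_supp_funpow_deriv: "smooth_supp p q f \<Longrightarrow> smooth_supp p q ((deriv ^^ k) f)"
  by (induction k) (auto intro: smooth_supp_deriv)

lemma smooth_supp_add_cmult:
  "smooth_supp p q f \<Longrightarrow> smooth_supp p q g \<Longrightarrow> smooth_supp p q (\<lambda>x. f x + c * g x)"
  by (simp add: smooth_supp_def smooth_add smooth_cmult)

lemma smooth_supp_shift:
  assumes "smooth_supp p q f"
  shows "smooth_supp (p + y) (q + y) (\<lambda>x. f (x - y))"
  using assms smooth_affine[of f 1 "- y"] by (auto simp: smooth_supp_def)

lemma smooth_supp_reflect:
  assumes "smooth_supp (- r) r f"
  shows "smooth_supp (- r) r (\<lambda>x. f (- x))"
  using assms smooth_affine[of f "-1" 0] by (auto simp: smooth_supp_def)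

lemma smooth_supp_bounded:
  assumes "smooth_supp p q f"
  obtains C where "C \<ge> 0" "\<And>x. \<bar>f x\<bar> \<le> C"
proof -
  have "compact (f ` {p..q})"
    by (intro compact_continuous_image smooth_continuous_on) (use assms in \<open>auto simp: smooth_supp_def\<close>)
  then obtain C where C: "\<And>x. x \<in> {p..q} \<Longrightarrow> \<bar>f x\<bar> \<le> C"
    by (meson bounded_real compact_imp_bounded imageI)
  have "\<bar>f x\<bar> \<le> max C 0" for x
    using C assms by (cases "x \<in> {p..q}") (auto simp: smooth_supp_def le_max_iff_disj)
  then show ?thesis by (intro that[of "max C 0"]) auto
qed

lemma smooth_borel_measurable: "smooth f \<Longrightarrow> f \<in> borel_measurable borel"
  by (intro borel_measurable_continuous_onI smooth_continuous_on)

text \<open>The positive and the negative part of f are densities of two finite measures that agree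
  on half-lines, hence on all Borel sets. By uniqueness of densities the two parts agree almost
  everywhere, and this is possible only where f = 0.\<close>

lemma AE_zero_if_interval_integrals_zero:
  fixes f :: "real \<Rightarrow> real"
  assumes int: "set_integrable lborel {p..q} f"
    and zero: "\<And>p' q'. p \<le> p' \<Longrightarrow> p' < q' \<Longrightarrow> q' \<le> q \<Longrightarrow> (LINT x:{p'<..<q'}|lborel. f x) = 0"
  shows "AE x in lborel. x \<in> {p..q} \<longrightarrow> f x = 0"
proof -
  define g where "g x = indicator {p..q} x * f x" for x
  have g[measurable]: "integrable lborel g"
    using int by (simp add: g_def[abs_def] set_integrable_def)
  \<comment> \<open>\<open>g\<close> lives on {p..q}, so up to null sets a half-line cuts out the
    interval from max x p to q, or nothing.\<close>
  have Z: "(LINT y|lborel. indicator {x<..} y * g y) = 0" for x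
  proof (cases "max x p < q")
    case True
    have "(LINT y|lborel. indicator {x<..} y * g y) = (LINT y|lborel. indicator {max x p<..<q} y * g y)"
    proof (rule integral_cong_AE)
      show "AE y in lborel. indicator {x<..} y * g y = indicator {max x p<..<q} y * g y"
        using AE_lborel_singleton[of p] AE_lborel_singleton[of q]
        by eventually_elim (auto simp: g_def indicator_def)
    qed auto
    also have "\<dots> = (LINT y:{max x p<..<q}|lborel. f y)"
      unfolding set_lebesgue_integral_def
      by (rule Bochner_Integration.integral_cong) (auto simp: g_def indicator_def)
    also have "\<dots> = 0" using True by (intro zero) auto
    finally show ?thesis .
  next
    case False
    have "AE y in lborel. indicator {x<..} y * g y = 0"
      using AE_lborel_singleton[of p] AE_lborel_singleton[of q]
      by eventually_elim (use False in \<open>auto simp: g_def indicator_def\<close>)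
    then show ?thesis by (rule integral_eq_zero_AE)
  qed
  have P: "integrable lborel (\<lambda>y. indicator {x<..} y * max 0 (g y))"
    and N: "integrable lborel (\<lambda>y. indicator {x<..} y * max 0 (- g y))" for x
    using integrable_mult_indicator[of "{x<..}" lborel "\<lambda>y. max 0 (g y)"]
      integrable_mult_indicator[of "{x<..}" lborel "\<lambda>y. max 0 (- g y)"] g by auto
  have eP: "emeasure (density lborel (\<lambda>y. ennreal (max 0 (g y)))) {x<..} =
      ennreal (LINT y|lborel. indicator {x<..} y * max 0 (g y))" for x
    by (subst emeasure_density)
       (auto simp: nn_integral_eq_integral[OF P, symmetric] ennreal_mult mult.commute ennreal_indicator
          intro!: nn_integral_cong split: split_indicator)
  have eN: "emeasure (density lborel (\<lambda>y. ennreal (max 0 (- g y)))) {x<..} =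
      ennreal (LINT y|lborel. indicator {x<..} y * max 0 (- g y))" for x
    by (subst emeasure_density)
       (auto simp: nn_integral_eq_integral[OF N, symmetric] ennreal_mult mult.commute ennreal_indicator
          intro!: nn_integral_cong split: split_indicator)
  have "density lborel (\<lambda>y. ennreal (max 0 (g y))) = density lborel (\<lambda>y. ennreal (max 0 (- g y)))"
  proof (rule measure_eqI_lessThan)
    fix x
    have "(LINT y|lborel. indicator {x<..} y * max 0 (g y)) - (LINT y|lborel. indicator {x<..} y * max 0 (- g y))
        = (LINT y|lborel. indicator {x<..} y * g y)"
      by (subst Bochner_Integration.integral_diff[OF P N, symmetric])
         (auto intro!: Bochner_Integration.integral_cong simp: max_def indicator_def)
    then show "emeasure (density lborel (\<lambda>y. ennreal (max 0 (g y)))) {x<..} =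
        emeasure (density lborel (\<lambda>y. ennreal (max 0 (- g y)))) {x<..}"
      using Z[of x] by (simp add: eP eN)
    show "emeasure (density lborel (\<lambda>y. ennreal (max 0 (g y)))) {x<..} < \<infinity>"
      by (simp add: eP)
  qed auto
  then have "AE y in lborel. ennreal (max 0 (g y)) = ennreal (max 0 (- g y))"
    by (intro sigma_finite_measure.density_unique[OF lborel.sigma_finite_measure_axioms]) auto
  then show ?thesis
    by eventually_elim (auto simp: g_def max_def split: if_splits)
qed

text \<open>The bumps are bounded by 1 and converge to indicators of open intervals, so dominated
  convergence reduces the claim to interval integrals.\<close>

lemma fundamental_lemma_interval:
  fixes f :: "real \<Rightarrow> real"
  assumes int: "set_integrable lborel {p..q} f"
    and zero: "\<And>\<psi>. smooth_supp p q \<psi> \<Longrightarrow> (LINT x|lborel. f x * \<psi> x) = 0"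
  shows "AE x in lborel. x \<in> {p..q} \<longrightarrow> f x = 0"
proof (rule AE_zero_if_interval_integrals_zero[OF int])
  fix p' q' assume pq: "p \<le> p'" "p' < q'" "q' \<le> q"
  define g where "g x = indicator {p..q} x * f x" for x
  have g[measurable]: "integrable lborel g"
    using int by (simp add: g_def[abs_def] set_integrable_def)
  have [measurable]: "bump n p' q' \<in> borel_measurable borel" for n
    by (intro smooth_borel_measurable smooth_bump)
  have "(\<lambda>n. LINT x|lborel. g x * bump n p' q' x) \<longlonglongrightarrow> (LINT x|lborel. g x * indicator {p'<..<q'} x)"
  proof (rule integral_dominated_convergence)
    show "integrable lborel (\<lambda>x. \<bar>g x\<bar>)" using g by simp
    show "AE x in lborel. (\<lambda>n. g x * bump n p' q' x) \<longlonglongrightarrow> g x * indicator {p'<..<q'} x"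
      by (intro AE_I2 tendsto_mult tendsto_const bump_tendsto)
    show "AE x in lborel. norm (g x * bump n p' q' x) \<le> \<bar>g x\<bar>" for n
      using bump_le_1 by (intro AE_I2) (auto simp: abs_mult mult_left_le)
  qed auto
  moreover have "(LINT x|lborel. g x * bump n p' q' x) = 0" for n
  proof -
    have "(LINT x|lborel. g x * bump n p' q' x) = (LINT x|lborel. f x * bump n p' q' x)"
    proof (intro Bochner_Integration.integral_cong refl)
      show "g x * bump n p' q' x = f x * bump n p' q' x" for x
        using pq bump_eq_0[of x p' q' n] by (cases "x \<in> {p..q}") (auto simp: g_def)
    qed
    then show ?thesis using zero[OF smooth_supp_bump] pq by simp
  qed
  ultimately have "(LINT x|lborel. g x * indicator {p'<..<q'} x) = 0"
    by (simp add: LIMSEQ_const_iff)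
  moreover have "(LINT x:{p'<..<q'}|lborel. f x) = (LINT x|lborel. g x * indicator {p'<..<q'} x)"
    unfolding set_lebesgue_integral_def
    using pq by (intro Bochner_Integration.integral_cong) (auto simp: g_def indicator_def)
  ultimately show "(LINT x:{p'<..<q'}|lborel. f x) = 0" by simp
qed

lemma continuous_AE_zero:
  fixes f :: "real \<Rightarrow> real"
  assumes "continuous_on {p..q} f" "p < q" "AE x in lborel. x \<in> {p..q} \<longrightarrow> f x = 0" "x \<in> {p..q}"
  shows "f x = 0"
proof (rule ccontr)
  assume "f x \<noteq> 0"
  then obtain d where d: "d > 0" "\<And>y. y \<in> {p..q} \<Longrightarrow> dist y x < d \<Longrightarrow> f y \<noteq> 0"
    using continuous_on_avoid[OF assms(1,4)] by (metis dist_commute)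
  \<comment> \<open>Cutting with {p..q} leaves an interval of positive length even if x is an
    endpoint, because p < q.\<close>
  define l where "l = max p (x - d / 2)"
  define u where "u = min q (x + d / 2)"
  have lu: "l < u" using assms d(1) by (auto simp: l_def u_def)
  have "y \<in> {p..q} \<and> f y \<noteq> 0" if "y \<in> {l..u}" for y
    using that d by (auto simp: l_def u_def dist_real_def abs_if intro!: d(2))
  then have "AE y in lborel. y \<notin> {l..u}"
    using assms(3) by (auto elim!: eventually_mono)
  then have "emeasure lborel {l..u} = 0"
    by (subst (asm) AE_iff_measurable[where N = "{l..u}"]) auto
  then show False using lu by simp
qed

section \<open>Pairings of square-integrable functions\<close>

lemma L2_mult_integrable:
  fixes f g :: "real \<Rightarrow> real"
  assumes "L2 f" "L2 g"
  shows "integrable lborel (\<lambda>x. f x * g x)"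
proof (rule Bochner_Integration.integrable_bound)
  show "integrable lborel (\<lambda>x. (f x)\<^sup>2 + (g x)\<^sup>2)"
    using assms by (auto simp: L2_def)
  show "(\<lambda>x. f x * g x) \<in> borel_measurable lborel"
    using assms by (auto simp: L2_def)
  show "AE x in lborel. norm (f x * g x) \<le> norm ((f x)\<^sup>2 + (g x)\<^sup>2)"
  proof (intro AE_I2)
    fix x
    have "2 * (\<bar>f x\<bar> * \<bar>g x\<bar>) \<le> (f x)\<^sup>2 + (g x)\<^sup>2"
      using sum_squares_bound[of "\<bar>f x\<bar>" "\<bar>g x\<bar>"] by simp
    then show "norm (f x * g x) \<le> norm ((f x)\<^sup>2 + (g x)\<^sup>2)"
      by (auto simp: abs_mult) (smt (verit) abs_ge_zero mult_nonneg_nonneg)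
  qed
qed

lemma L2_Cauchy_Schwarz:
  fixes f g :: "real \<Rightarrow> real"
  assumes "L2 f" "L2 g"
  shows "\<bar>LINT x|lborel. f x * g x\<bar> \<le> L2_norm f * L2_norm g"
proof -
  have m[measurable]: "f \<in> borel_measurable borel" "g \<in> borel_measurable borel"
    and i: "integrable lborel (\<lambda>x. (f x)\<^sup>2)" "integrable lborel (\<lambda>x. (g x)\<^sup>2)"
    using assms by (auto simp: L2_def)
  define I where "I = (LINT x|lborel. \<bar>f x * g x\<bar>)"
  have I: "(\<integral>\<^sup>+ x. ennreal \<bar>f x\<bar> * ennreal \<bar>g x\<bar> \<partial>lborel) = ennreal I"
    unfolding I_def using integrable_abs[OF L2_mult_integrable[OF assms]]
    by (subst nn_integral_eq_integral[symmetric]) (auto simp: abs_mult ennreal_mult)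
  have "(ennreal I)\<^sup>2 \<le> (\<integral>\<^sup>+ x. (ennreal \<bar>f x\<bar>)\<^sup>2 \<partial>lborel) * (\<integral>\<^sup>+ x. (ennreal \<bar>g x\<bar>)\<^sup>2 \<partial>lborel)"
    unfolding I[symmetric] by (rule Cauchy_Schwarz_nn_integral) auto
  also have "\<dots> = ennreal (LINT x|lborel. (f x)\<^sup>2) * ennreal (LINT x|lborel. (g x)\<^sup>2)"
    using i by (simp add: nn_integral_eq_integral[symmetric] ennreal_power)
  also have "\<dots> = ennreal ((LINT x|lborel. (f x)\<^sup>2) * (LINT x|lborel. (g x)\<^sup>2))"
    by (simp add: ennreal_mult)
  finally have "I\<^sup>2 \<le> (LINT x|lborel. (f x)\<^sup>2) * (LINT x|lborel. (g x)\<^sup>2)"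
    by (simp add: ennreal_power I_def)
  then have "I \<le> sqrt ((LINT x|lborel. (f x)\<^sup>2) * (LINT x|lborel. (g x)\<^sup>2))"
    by (rule real_le_rsqrt)
  also have "\<dots> = L2_norm f * L2_norm g"
    by (simp add: L2_norm_def real_sqrt_mult)
  finally have "I \<le> L2_norm f * L2_norm g" .
  moreover have "\<bar>LINT x|lborel. f x * g x\<bar> \<le> I"
    unfolding I_def by (rule integral_abs_bound)
  ultimately show ?thesis by simp
qed

lemma L2_set_integrable:
  fixes f :: "real \<Rightarrow> real"
  assumes "L2 f"
  shows "set_integrable lborel {p..q} f"
proof -
  have "L2 (indicator {p..q} :: real \<Rightarrow> real)"
  proof -
    have "(norm (indicator {p..q} x :: real))\<^sup>2 = indicator {p..q} x" for x :: real
      by (simp add: indicator_def)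
    moreover have "integrable lborel (indicator {p..q} :: real \<Rightarrow> real)"
      by (intro integrable_real_indicator) (auto simp: emeasure_lborel_Icc_eq)
    ultimately show ?thesis by (simp add: L2_def)
  qed
  from L2_mult_integrable[OF this assms] show ?thesis by (simp add: set_integrable_def)
qed

lemma smooth_supp_L2:
  assumes "smooth_supp p q f"
  shows "L2 f"
proof -
  obtain C where C: "C \<ge> 0" "\<And>x. \<bar>f x\<bar> \<le> C" using smooth_supp_bounded[OF assms] by blast
  have [measurable]: "f \<in> borel_measurable borel"
    using assms by (intro smooth_borel_measurable) (simp add: smooth_supp_def)
  have "integrable lborel (\<lambda>x. (f x)\<^sup>2)"
  proof (rule Bochner_Integration.integrable_bound)
    show "integrable lborel (\<lambda>x. C\<^sup>2 * indicator {p..q} x)"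
      by (intro integrable_mult_right integrable_real_indicator) (auto simp: emeasure_lborel_Icc_eq)
    show "AE x in lborel. norm ((f x)\<^sup>2) \<le> norm (C\<^sup>2 * indicator {p..q} x)"
    proof (intro AE_I2)
      fix x
      show "norm ((f x)\<^sup>2) \<le> norm (C\<^sup>2 * indicator {p..q} x)"
        using C assms by (cases "x \<in> {p..q}") (auto simp: smooth_supp_def abs_le_square_iff[symmetric])
    qed
  qed auto
  then show ?thesis by (simp add: L2_def)
qed

section \<open>Injectivity of the operator on square-integrable functions\<close>

text \<open>The cross-correlation: f mollified with the reflection of \<rho>. It is differentiable
  in y although f is only in L2, since derivatives fall on \<rho>.\<close>

definition corr :: "(real \<Rightarrow> real) \<Rightarrow> (real \<Rightarrow> real) \<Rightarrow> real \<Rightarrow> real" where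
  "corr f \<rho> y = (LINT x|lborel. f x * \<rho> (x - y))"

text \<open>Along a sequence tending to y the translations stay bounded by some M, so all difference
  quotients of \<rho> are supported in {p - M..q + M} and bounded by the Lipschitz constant C. As f
  is integrable on that interval, dominated convergence applies.\<close>

lemma corr_has_derivative:
  assumes f: "L2 f" and \<rho>: "smooth_supp p q \<rho>"
  shows "(corr f \<rho> has_real_derivative - corr f (deriv \<rho>) y) (at y)"
  unfolding has_field_derivative_iff tendsto_at_iff_sequentially comp_def
proof (intro allI impI)
  fix X :: "nat \<Rightarrow> real"
  assume X: "\<forall>i. X i \<in> UNIV - {y}" "X \<longlonglongrightarrow> y"
  obtain M0 where M0: "\<And>n. \<bar>X n\<bar> \<le> M0"
    using convergent_imp_Bseq[OF convergentI[OF X(2)]] by (auto simp: Bseq_def)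
  define M where "M = max M0 \<bar>y\<bar>"
  have M: "\<bar>X n\<bar> \<le> M \<and> \<bar>y\<bar> \<le> M" for n using M0[of n] by (auto simp: M_def)
  have s\<rho>: "smooth \<rho>" and z\<rho>: "\<And>x. x \<notin> {p..q} \<Longrightarrow> \<rho> x = 0" using \<rho> by (auto simp: smooth_supp_def)
  obtain C where C: "C \<ge> 0" "\<And>x. \<bar>deriv \<rho> x\<bar> \<le> C"
    using smooth_supp_bounded[OF smooth_supp_deriv[OF \<rho>]] by blast
  have lip: "\<bar>\<rho> b - \<rho> a\<bar> \<le> C * \<bar>b - a\<bar>" for a b
    using field_differentiable_bound[of UNIV \<rho> "deriv \<rho>" C b a] C smooth_DERIV[OF s\<rho>] by auto
  have [measurable]: "f \<in> borel_measurable borel" "\<rho> \<in> borel_measurable borel" "deriv \<rho> \<in> borel_measurable borel"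
    using f s\<rho> by (auto simp: L2_def intro!: smooth_borel_measurable smooth_deriv)
  have int: "integrable lborel (\<lambda>x. f x * \<rho> (x - y))" for y
    by (intro L2_mult_integrable f smooth_supp_L2[OF smooth_supp_shift[OF \<rho>]])
  define S where "S n x = f x * ((\<rho> (x - X n) - \<rho> (x - y)) / (X n - y))" for n x
  have "(\<lambda>n. LINT x|lborel. S n x) \<longlonglongrightarrow> (LINT x|lborel. - (f x * deriv \<rho> (x - y)))"
  proof (rule integral_dominated_convergence)
    show "integrable lborel (\<lambda>x. C * \<bar>indicator {p - M..q + M} x *\<^sub>R f x\<bar>)"
      using L2_set_integrable[OF f, of "p - M" "q + M"] unfolding set_integrable_def
      by (intro integrable_mult_right integrable_abs) auto
    show "AE x in lborel. (\<lambda>n. S n x) \<longlonglongrightarrow> - (f x * deriv \<rho> (x - y))"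
    proof (intro AE_I2)
      fix x
      have "((\<lambda>z. \<rho> (x - z)) has_real_derivative deriv \<rho> (x - y) * (- 1)) (at y)"
        by (rule DERIV_chain2[OF smooth_DERIV[OF s\<rho>]]) (auto intro!: derivative_eq_intros)
      then have "(\<lambda>n. (\<rho> (x - X n) - \<rho> (x - y)) / (X n - y)) \<longlonglongrightarrow> - deriv \<rho> (x - y)"
        using X unfolding has_field_derivative_iff tendsto_at_iff_sequentially comp_def by auto
      from tendsto_mult[OF tendsto_const[of "f x"] this]
      show "(\<lambda>n. S n x) \<longlonglongrightarrow> - (f x * deriv \<rho> (x - y))" by (simp add: S_def)
    qed
    show "AE x in lborel. norm (S n x) \<le> C * \<bar>indicator {p - M..q + M} x *\<^sub>R f x\<bar>" for n
    proof (intro AE_I2)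
      fix x
      have "X n \<noteq> y" using X by auto
      show "norm (S n x) \<le> C * \<bar>indicator {p - M..q + M} x *\<^sub>R f x\<bar>"
      proof (cases "x \<in> {p - M..q + M}")
        case True
        have "\<bar>(\<rho> (x - X n) - \<rho> (x - y)) / (X n - y)\<bar> \<le> C"
          using lip[of "x - X n" "x - y"] \<open>X n \<noteq> y\<close> by (simp add: abs_divide divide_le_eq abs_minus_commute)
        then have "norm (S n x) \<le> \<bar>f x\<bar> * C"
          unfolding S_def real_norm_def abs_mult by (rule mult_left_mono) simp
        then show ?thesis using True by (simp add: mult.commute)
      next
        case False
        then have "x - X n \<notin> {p..q}" "x - y \<notin> {p..q}" using M[of n] by auto
        then show ?thesis using C by (simp add: S_def z\<rho>)
      qed
    qed
  qed (auto simp: S_def)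
  moreover have "(LINT x|lborel. S n x) = (corr f \<rho> (X n) - corr f \<rho> y) / (X n - y)" for n
  proof -
    have "(LINT x|lborel. S n x) = (LINT x|lborel. (f x * \<rho> (x - X n) - f x * \<rho> (x - y)) / (X n - y))"
      by (simp add: S_def right_diff_distrib)
    also have "\<dots> = (LINT x|lborel. f x * \<rho> (x - X n) - f x * \<rho> (x - y)) / (X n - y)"
      by (rule integral_divide_zero)
    also have "\<dots> = (corr f \<rho> (X n) - corr f \<rho> y) / (X n - y)"
      unfolding corr_def by (subst Bochner_Integration.integral_diff[OF int int]) simp
    finally show ?thesis .
  qed
  ultimately show "(\<lambda>n. (corr f \<rho> (X n) - corr f \<rho> y) / (X n - y)) \<longlonglongrightarrow> - corr f (deriv \<rho>) y"
    by (simp add: corr_def)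
qed

text \<open>The pairing sees f only on the translated support, and the L2 mass of f there vanishes
  as the support escapes to infinity. The sign \<sigma> treats both ends of the line at
  once.\<close>

lemma corr_tendsto_0:
  assumes f: "L2 f" and \<rho>: "smooth_supp p q \<rho>" and \<sigma>: "\<bar>\<sigma>\<bar> = (1::real)"
  shows "((\<lambda>y. corr f \<rho> (\<sigma> * y)) \<longlongrightarrow> 0) at_top"
proof -
  have [measurable]: "f \<in> borel_measurable borel" and i: "integrable lborel (\<lambda>x. (f x)\<^sup>2)"
    using f by (auto simp: L2_def)
  define g where "g y x = indicator {p + \<sigma> * y..q + \<sigma> * y} x * f x" for x y
  have [measurable]: "g y \<in> borel_measurable borel" for y by (simp add: g_def[abs_def])
  have le: "(g y x)\<^sup>2 \<le> (f x)\<^sup>2" for x y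
    by (auto simp: g_def indicator_def)
  have g: "L2 (g y)" for y
    unfolding L2_def using le by (auto intro!: Bochner_Integration.integrable_bound[OF i])
  have "((\<lambda>y. LINT x|lborel. (g y x)\<^sup>2) \<longlongrightarrow> (LINT x|(lborel::real measure). 0)) at_top"
  proof (rule integral_dominated_convergence_at_top[OF _ _ i])
    show "AE x in lborel. ((\<lambda>y. (g y x)\<^sup>2) \<longlongrightarrow> 0) at_top"
    proof (intro AE_I2 tendsto_eventually)
      fix x
      show "\<forall>\<^sub>F y in at_top. (g y x)\<^sup>2 = 0"
        using eventually_gt_at_top[of "\<bar>x\<bar> + \<bar>p\<bar> + \<bar>q\<bar>"]
        by eventually_elim (use \<sigma> in \<open>auto simp: g_def indicator_def abs_if split: if_splits\<close>)
    qed
    show "\<forall>\<^sub>F y in at_top. AE x in lborel. norm ((g y x)\<^sup>2) \<le> (f x)\<^sup>2"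
      using le by auto
  qed auto
  then have "((\<lambda>y. L2_norm (g y)) \<longlongrightarrow> 0) at_top"
    unfolding L2_norm_def using tendsto_real_sqrt by fastforce
  then have lim: "((\<lambda>y. L2_norm (g y) * L2_norm \<rho>) \<longlongrightarrow> 0) at_top"
    by (rule tendsto_mult_left_zero)
  have "\<bar>corr f \<rho> (\<sigma> * y)\<bar> \<le> L2_norm (g y) * L2_norm \<rho>" for y
  proof -
    have "corr f \<rho> (\<sigma> * y) = (LINT x|lborel. g y x * \<rho> (x - \<sigma> * y))"
      unfolding corr_def
    proof (intro Bochner_Integration.integral_cong refl)
      show "f x * \<rho> (x - \<sigma> * y) = g y x * \<rho> (x - \<sigma> * y)" for x
        using \<rho> by (cases "x - \<sigma> * y \<in> {p..q}") (auto simp: g_def smooth_supp_def indicator_def)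
    qed
    also have "\<bar>\<dots>\<bar> \<le> L2_norm (g y) * L2_norm (\<lambda>x. \<rho> (x - \<sigma> * y))"
      by (intro L2_Cauchy_Schwarz g smooth_supp_L2[OF smooth_supp_shift[OF \<rho>]])
    also have "L2_norm (\<lambda>x. \<rho> (x - \<sigma> * y)) = L2_norm \<rho>"
      unfolding L2_norm_def
      using lborel_integral_real_affine[of 1 "\<lambda>x. (norm (\<rho> x))\<^sup>2" "- (\<sigma> * y)"] by simp
    finally show ?thesis .
  qed
  then show ?thesis
    by (intro Lim_null_comparison[OF _ lim]) auto
qed

text \<open>The energy flux \<open>E\<close> below is nonincreasing along solutions and vanishes at both ends.\<close>

lemma rosenau_ode_decaying_zero:
  fixes \<alpha> \<beta> :: real and u :: "nat \<Rightarrow> real \<Rightarrow> real"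
  assumes ab: "\<alpha> \<ge> 0" "\<beta> \<ge> 0"
    and d: "\<And>k x. (u k has_real_derivative u (Suc k) x) (at x)"
    and top: "\<And>k. (u k \<longlongrightarrow> 0) at_top" and bot: "\<And>k. (u k \<longlongrightarrow> 0) at_bot"
    and eq: "\<And>x. u 0 x - \<alpha> * u 2 x + \<beta> * u 4 x = 0"
  shows "u 0 x = 0"
proof -
  \<comment> \<open>Multiplying the equation by \<open>u 0\<close> and integrating by parts leaves
    the quadratic form \<open>F\<close>; \<open>E\<close> collects the boundary terms, whence E' =
    -F. Once E is identically 0, so is F, a sum of nonnegative terms one of which is the square of
    \<open>u 0\<close>.\<close>
  define E where "E x = \<beta> * (u 0 x * u 3 x - u 1 x * u 2 x) - \<alpha> * (u 0 x * u 1 x)" for x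
  define F where "F x = (u 0 x)\<^sup>2 + \<alpha> * (u 1 x)\<^sup>2 + \<beta> * (u 2 x)\<^sup>2" for x
  have dE: "(E has_real_derivative - F x) (at x)" for x
  proof -
    have d': "(u 0 has_real_derivative u 1 x) (at x)" "(u 1 has_real_derivative u 2 x) (at x)"
       "(u 2 has_real_derivative u 3 x) (at x)" "(u 3 has_real_derivative u 4 x) (at x)"
      using d[of 0 x] d[of 1 x] d[of 2 x] d[of 3 x] by (simp_all add: eval_nat_numeral)
    have D: "(E has_real_derivative
        \<beta> * ((u 1 x * u 3 x + u 0 x * u 4 x) - (u 2 x * u 2 x + u 1 x * u 3 x))
        - \<alpha> * (u 1 x * u 1 x + u 0 x * u 2 x)) (at x)"
      unfolding E_def[abs_def]
      by (rule DERIV_cong[OF DERIV_diff[OF DERIV_cmult[OF DERIV_diff[OF DERIV_mult[OF d'(1,4)]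
              DERIV_mult[OF d'(2,3)]]] DERIV_cmult[OF DERIV_mult[OF d'(1,2)]]]])
         (simp only: algebra_simps)
    have b4: "\<beta> * u 4 x = \<alpha> * u 2 x - u 0 x" using eq[of x] by simp
    have "\<beta> * ((u 1 x * u 3 x + u 0 x * u 4 x) - (u 2 x * u 2 x + u 1 x * u 3 x))
        - \<alpha> * (u 1 x * u 1 x + u 0 x * u 2 x)
        = u 0 x * (\<beta> * u 4 x) - \<beta> * (u 2 x * u 2 x) - \<alpha> * (u 1 x * u 1 x) - \<alpha> * (u 0 x * u 2 x)"
      by (simp add: algebra_simps)
    also have "\<dots> = - F x"
      unfolding b4 F_def power2_eq_square by (simp add: algebra_simps)
    finally have "\<beta> * ((u 1 x * u 3 x + u 0 x * u 4 x) - (u 2 x * u 2 x + u 1 x * u 3 x))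
        - \<alpha> * (u 1 x * u 1 x + u 0 x * u 2 x) = - F x" .
    with D show ?thesis by simp
  qed
  have F0: "F x \<ge> 0" for x using ab by (simp add: F_def)
  have mono: "E y \<le> E x" if "x \<le> y" for x y
    using DERIV_nonpos_imp_nonincreasing[OF that, of E] dE F0 by (metis neg_le_0_iff_le)
  have "(E \<longlongrightarrow> \<beta> * (0 * 0 - 0 * 0) - \<alpha> * (0 * 0)) at_top"
    "(E \<longlongrightarrow> \<beta> * (0 * 0 - 0 * 0) - \<alpha> * (0 * 0)) at_bot"
    unfolding E_def[abs_def] by (intro tendsto_intros top bot)+
  then have Et: "(E \<longlongrightarrow> 0) at_top" and Eb: "(E \<longlongrightarrow> 0) at_bot" by simp_all
  have "E x \<ge> 0" for x
    by (rule tendsto_upperbound[OF Et]) (auto intro!: eventually_mono[OF eventually_ge_at_top[of x]] mono)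
  moreover have "E x \<le> 0" for x
    by (rule tendsto_lowerbound[OF Eb]) (auto intro!: eventually_mono[OF eventually_le_at_bot[of x]] mono)
  ultimately have "E = (\<lambda>x. 0)" by (auto intro: antisym)
  then have "F x = 0" using dE[of x] DERIV_unique[OF _ DERIV_const] by fastforce
  then have "(u 0 x)\<^sup>2 \<le> 0" using ab unfolding F_def
    by (metis add_nonneg_nonneg add_increasing2 le_add_same_cancel1 add.assoc mult_nonneg_nonneg zero_le_power2)
  then show ?thesis by simp
qed

text \<open>The operator L on functions of x alone. Having only terms of even order, it is formally
  self-adjoint and preserves parity.\<close>

definition rosenau :: "real \<Rightarrow> real \<Rightarrow> (real \<Rightarrow> real) \<Rightarrow> real \<Rightarrow> real" where
  "rosenau \<alpha> \<beta> \<eta> x = \<eta> x - \<alpha> * (deriv ^^ 2) \<eta> x + \<beta> * (deriv ^^ 4) \<eta> x"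

lemma smooth_supp_rosenau:
  assumes "smooth_supp p q \<eta>"
  shows "smooth_supp p q (rosenau \<alpha> \<beta> \<eta>)"
proof -
  have "smooth_supp p q (\<lambda>x. (\<eta> x + (- \<alpha>) * (deriv ^^ 2) \<eta> x) + \<beta> * (deriv ^^ 4) \<eta> x)"
    by (intro smooth_supp_add_cmult smooth_supp_funpow_deriv assms)
  then show ?thesis by (simp add: rosenau_def[abs_def])
qed

text \<open>Each derivative in y moves to \<rho> with a minus sign, hence the factor (-1)^k. This is
  the family of successive derivatives, decaying at both ends, to which the energy argument applies;
  for k = 2 and k = 4 the sign disappears.\<close>

lemma corr_funpow_derivs:
  assumes f: "L2 f" and \<rho>: "smooth_supp p q \<rho>"
  defines "u \<equiv> \<lambda>k y. (- 1) ^ k * corr f ((deriv ^^ k) \<rho>) y"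
  shows "(u k has_real_derivative u (Suc k) y) (at y)"
    and "(u k \<longlongrightarrow> 0) at_top" and "(u k \<longlongrightarrow> 0) at_bot"
proof -
  note \<rho>k = smooth_supp_funpow_deriv[OF \<rho>]
  show "(u k has_real_derivative u (Suc k) y) (at y)"
    unfolding u_def using DERIV_cmult[OF corr_has_derivative[OF f \<rho>k[of k]], of "(- 1) ^ k" y]
    by (simp add: mult_ac)
  show "(u k \<longlongrightarrow> 0) at_top"
    unfolding u_def using corr_tendsto_0[OF f \<rho>k[of k], of 1] by (intro tendsto_mult_right_zero) simp
  show "(u k \<longlongrightarrow> 0) at_bot"
    unfolding u_def filterlim_at_bot_mirror
    using corr_tendsto_0[OF f \<rho>k[of k], of "-1"] by (intro tendsto_mult_right_zero) simp
qed

lemma corr_rosenau: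
  assumes f: "L2 f" and \<rho>: "smooth_supp p q \<rho>"
  shows "corr f (rosenau \<alpha> \<beta> \<rho>) y =
    corr f \<rho> y - \<alpha> * corr f ((deriv ^^ 2) \<rho>) y + \<beta> * corr f ((deriv ^^ 4) \<rho>) y"
proof -
  have i: "integrable lborel (\<lambda>x. f x * (deriv ^^ k) \<rho> (x - y))" for k
    by (intro L2_mult_integrable f
        smooth_supp_L2[OF smooth_supp_shift[OF smooth_supp_funpow_deriv[OF \<rho>]]])
  have "corr f (rosenau \<alpha> \<beta> \<rho>) y = (LINT x|lborel. f x * (deriv ^^ 0) \<rho> (x - y)
     - \<alpha> * (f x * (deriv ^^ 2) \<rho> (x - y)) + \<beta> * (f x * (deriv ^^ 4) \<rho> (x - y)))"
    unfolding corr_def rosenau_def by (intro Bochner_Integration.integral_cong) (auto simp: algebra_simps)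
  also have "\<dots> = (LINT x|lborel. f x * (deriv ^^ 0) \<rho> (x - y))
     - \<alpha> * (LINT x|lborel. f x * (deriv ^^ 2) \<rho> (x - y)) + \<beta> * (LINT x|lborel. f x * (deriv ^^ 4) \<rho> (x - y))"
    using i by (simp only: Bochner_Integration.integral_add Bochner_Integration.integral_diff
        integral_mult_right_zero integrable_mult_right Bochner_Integration.integrable_diff)
  finally show ?thesis by (simp add: corr_def)
qed

text \<open>Mollification turns the distributional equation L f = 0 into a classical differential
  equation for a function that decays with all its derivatives.\<close>

lemma corr_zero_if_rosenau_zero:
  assumes ab: "\<alpha> \<ge> 0" "\<beta> \<ge> 0" and f: "L2 f" and \<rho>: "smooth_supp p q \<rho>"
    and zero: "\<And>y. corr f (rosenau \<alpha> \<beta> \<rho>) y = 0"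
  shows "corr f \<rho> y = 0"
proof -
  define u where "u k y = (- 1) ^ k * corr f ((deriv ^^ k) \<rho>) y" for k y
  note u = corr_funpow_derivs[OF f \<rho>, folded u_def]
  have "u 0 x - \<alpha> * u 2 x + \<beta> * u 4 x = 0" for x
    using zero[of x] unfolding corr_rosenau[OF f \<rho>] by (simp add: u_def)
  from rosenau_ode_decaying_zero[OF ab u this]
  have "u 0 y = 0" .
  then show ?thesis by (simp add: u_def)
qed

lemma AE_zero_if_smooth_integrals_zero:
  assumes f: "L2 f" and zero: "\<And>p q \<rho>. smooth_supp p q \<rho> \<Longrightarrow> (LINT x|lborel. f x * \<rho> x) = 0"
  shows "AE x in lborel. f x = (0::real)"
proof -
  have "AE x in lborel. \<forall>n::nat. x \<in> {- real n..real n} \<longrightarrow> f x = 0"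
    unfolding AE_all_countable
    by (intro allI fundamental_lemma_interval L2_set_integrable f zero)
  then show ?thesis
  proof eventually_elim
    fix x assume "\<forall>n::nat. x \<in> {- real n..real n} \<longrightarrow> f x = 0"
    moreover obtain n :: nat where "\<bar>x\<bar> \<le> real n" using real_arch_simple by blast
    ultimately show "f x = 0" by (metis abs_le_D1 abs_le_D2 atLeastAtMost_iff minus_le_iff)
  qed
qed

lemma funpow_deriv_shift:
  assumes "smooth f"
  shows "(deriv ^^ k) (\<lambda>x. f (x - y)) = (\<lambda>x. (deriv ^^ k) f (x - y))"
  using funpow_deriv_affine[OF assms, of k 1 "- y"] by simp

lemma rosenau_shift:
  assumes "smooth \<rho>"
  shows "rosenau \<alpha> \<beta> (\<lambda>x. \<rho> (x - y)) = (\<lambda>x. rosenau \<alpha> \<beta> \<rho> (x - y))"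
  unfolding rosenau_def funpow_deriv_shift[OF assms] ..

text \<open>Translates of a test function are again test functions, so the hypothesis gives the
  equation at every y; the conclusion is read off at y = 0.\<close>

lemma rosenau_injective:
  assumes ab: "\<alpha> \<ge> 0" "\<beta> \<ge> 0" and f: "L2 f"
    and zero: "\<And>p q \<rho>. smooth_supp p q \<rho> \<Longrightarrow> (LINT x|lborel. f x * rosenau \<alpha> \<beta> \<rho> x) = 0"
  shows "AE x in lborel. f x = 0"
proof (rule AE_zero_if_smooth_integrals_zero[OF f])
  fix p q \<rho> assume \<rho>: "smooth_supp p q \<rho>"
  have "corr f (rosenau \<alpha> \<beta> \<rho>) y = 0" for y
    using zero[OF smooth_supp_shift[OF \<rho>, of y]]
    by (simp add: corr_def rosenau_shift smooth_supp_smooth[OF \<rho>])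
  then have "corr f \<rho> 0 = 0" by (rule corr_zero_if_rosenau_zero[OF ab f \<rho>])
  then show "(LINT x|lborel. f x * \<rho> x) = 0" by (simp add: corr_def)
qed

text \<open>After L has been removed, \<open>corr f\<close> \<rho> has derivative 0 and is constant;
  since it tends to 0 at infinity, the constant is 0. This is what forces the profile to vanish in
  the degenerate case.\<close>

lemma rosenau_deriv_injective:
  assumes ab: "\<alpha> \<ge> 0" "\<beta> \<ge> 0" and f: "L2 f"
    and zero: "\<And>p q \<rho>. smooth_supp p q \<rho> \<Longrightarrow> (LINT x|lborel. f x * rosenau \<alpha> \<beta> (deriv \<rho>) x) = 0"
  shows "AE x in lborel. f x = 0"
proof (rule AE_zero_if_smooth_integrals_zero[OF f])
  fix p q \<rho> assume \<rho>: "smooth_supp p q \<rho>"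
  have "corr f (rosenau \<alpha> \<beta> (deriv \<rho>)) y = 0" for y
    using zero[OF smooth_supp_shift[OF \<rho>, of y]]
      funpow_deriv_shift[OF smooth_supp_smooth[OF \<rho>], of 1 y]
    by (simp add: corr_def rosenau_shift smooth_supp_smooth[OF smooth_supp_deriv[OF \<rho>]])
  then have "corr f (deriv \<rho>) y = 0" for y
    by (rule corr_zero_if_rosenau_zero[OF ab f smooth_supp_deriv[OF \<rho>]])
  then have "(corr f \<rho> has_real_derivative 0) (at y)" for y
    using corr_has_derivative[OF f \<rho>, of y] by simp
  then have c: "corr f \<rho> y = corr f \<rho> 0" for y
    using DERIV_isconst_all[of "corr f \<rho>" y 0] by blast
  have e: "(\<lambda>y. corr f \<rho> (1 * y)) = (\<lambda>y. corr f \<rho> 0)" by (rule ext) (rule c)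
  have "corr f \<rho> 0 = 0"
    using corr_tendsto_0[OF f \<rho>, of 1] unfolding e by (simp add: tendsto_const_iff)
  then show "(LINT x|lborel. f x * \<rho> x) = 0" by (simp add: corr_def)
qed

section \<open>Test functions moving along a curve\<close>

lemma DERIV_mult_shift:
  assumes "smooth \<psi>" "smooth \<eta>" "smooth \<gamma>"
  shows "((\<lambda>r. \<psi> r * \<eta> (x - \<gamma> r)) has_real_derivative
      deriv \<psi> t * \<eta> (x - \<gamma> t) + (- (\<psi> t * deriv \<gamma> t)) * deriv \<eta> (x - \<gamma> t)) (at t)"
    and "((\<lambda>y. \<psi> t * \<eta> (y - \<gamma> t)) has_real_derivative \<psi> t * deriv \<eta> (x - \<gamma> t)) (at x)"
proof -
  have "((\<lambda>r. x - \<gamma> r) has_real_derivative 0 - deriv \<gamma> t) (at t)"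
    by (intro DERIV_diff DERIV_const smooth_DERIV assms)
  from DERIV_mult[OF smooth_DERIV[OF assms(1)] DERIV_chain2[OF smooth_DERIV[OF assms(2)] this]]
  show "((\<lambda>r. \<psi> r * \<eta> (x - \<gamma> r)) has_real_derivative
      deriv \<psi> t * \<eta> (x - \<gamma> t) + (- (\<psi> t * deriv \<gamma> t)) * deriv \<eta> (x - \<gamma> t)) (at t)"
    by (simp add: algebra_simps)
  have "((\<lambda>y. y - \<gamma> t) has_real_derivative 1 - 0) (at x)"
    by (intro DERIV_diff DERIV_const DERIV_ident)
  from DERIV_cmult[OF DERIV_chain2[OF smooth_DERIV[OF assms(2)] this], of "\<psi> t"]
  show "((\<lambda>y. \<psi> t * \<eta> (y - \<gamma> t)) has_real_derivative \<psi> t * deriv \<eta> (x - \<gamma> t)) (at x)" by simp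
qed

lemma Dt_mult_shift:
  assumes "smooth \<psi>" "smooth \<eta>" "smooth \<gamma>"
  shows "Dt (\<lambda>t x. \<psi> t * \<eta> (x - \<gamma> t)) =
    (\<lambda>t x. deriv \<psi> t * \<eta> (x - \<gamma> t) + (- (\<psi> t * deriv \<gamma> t)) * deriv \<eta> (x - \<gamma> t))"
  unfolding Dt_def by (intro ext DERIV_imp_deriv DERIV_mult_shift assms)

lemma funpow_Dx_mult_shift:
  assumes "smooth \<eta>"
  shows "(Dx ^^ k) (\<lambda>t x. \<psi> t * \<eta> (x - \<gamma> t)) = (\<lambda>t x. \<psi> t * (deriv ^^ k) \<eta> (x - \<gamma> t))"
proof (induction k)
  case (Suc k)
  have "deriv (\<lambda>y. \<psi> t * (deriv ^^ k) \<eta> (y - \<gamma> t)) x = \<psi> t * deriv ((deriv ^^ k) \<eta>) (x - \<gamma> t)" for t x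
    using DERIV_mult_shift(2)[OF smooth_const[of "\<psi> t"] smooth_funpow_deriv[OF assms] smooth_const[of "\<gamma> t"]]
    by (intro DERIV_imp_deriv) simp
  then show ?case by (simp add: Suc) (simp add: Dx_def[abs_def])
qed simp

text \<open>The time derivative of a moving product is a sum of two moving products, and L has to be
  applied to it.\<close>

lemma funpow_Dx_add_mult_shift:
  assumes "smooth \<eta>" "smooth \<theta>"
  shows "(Dx ^^ k) (\<lambda>t x. \<psi> t * \<eta> (x - \<gamma> t) + \<phi> t * \<theta> (x - \<gamma> t)) =
    (\<lambda>t x. \<psi> t * (deriv ^^ k) \<eta> (x - \<gamma> t) + \<phi> t * (deriv ^^ k) \<theta> (x - \<gamma> t))"
proof (induction k)
  case (Suc k)
  have "deriv (\<lambda>y. \<psi> t * (deriv ^^ k) \<eta> (y - \<gamma> t) + \<phi> t * (deriv ^^ k) \<theta> (y - \<gamma> t)) x =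
      \<psi> t * deriv ((deriv ^^ k) \<eta>) (x - \<gamma> t) + \<phi> t * deriv ((deriv ^^ k) \<theta>) (x - \<gamma> t)" for t x
    using DERIV_mult_shift(2)[OF smooth_const[of "\<psi> t"] smooth_funpow_deriv[OF assms(1)] smooth_const[of "\<gamma> t"]]
      DERIV_mult_shift(2)[OF smooth_const[of "\<phi> t"] smooth_funpow_deriv[OF assms(2)] smooth_const[of "\<gamma> t"]]
    by (intro DERIV_imp_deriv DERIV_add) simp_all
  then show ?case by (simp add: Suc) (simp add: Dx_def[abs_def])
qed simp

lemma Ck_add:
  assumes "Ck k \<phi>" "Ck k \<theta>"
  shows "Ck k (\<lambda>t x. \<phi> t x + \<theta> t x)"
  using assms
proof (induction k arbitrary: \<phi> \<theta>)
  case 0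
  then show ?case by (auto simp: case_prod_beta intro: continuous_on_add)
next
  case (Suc k)
  have d: "((\<lambda>r. \<phi> r x) has_real_derivative Dt \<phi> t x) (at t)" "((\<lambda>y. \<phi> t y) has_real_derivative Dx \<phi> t x) (at x)"
    "((\<lambda>r. \<theta> r x) has_real_derivative Dt \<theta> t x) (at t)" "((\<lambda>y. \<theta> t y) has_real_derivative Dx \<theta> t x) (at x)" for t x
    using Suc.prems by (auto simp: Dt_def Dx_def DERIV_deriv_iff_real_differentiable)
  have t: "((\<lambda>r. \<phi> r x + \<theta> r x) has_real_derivative Dt \<phi> t x + Dt \<theta> t x) (at t)"
    and x: "((\<lambda>y. \<phi> t y + \<theta> t y) has_real_derivative Dx \<phi> t x + Dx \<theta> t x) (at x)" for t x
    by (intro DERIV_add d)+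
  have "Dt (\<lambda>t x. \<phi> t x + \<theta> t x) = (\<lambda>t x. Dt \<phi> t x + Dt \<theta> t x)"
    "Dx (\<lambda>t x. \<phi> t x + \<theta> t x) = (\<lambda>t x. Dx \<phi> t x + Dx \<theta> t x)"
    unfolding Dt_def[of "\<lambda>t x. \<phi> t x + \<theta> t x"] Dx_def[of "\<lambda>t x. \<phi> t x + \<theta> t x"]
    using t x by (auto intro!: ext DERIV_imp_deriv)
  moreover have "(\<lambda>r. \<phi> r x + \<theta> r x) differentiable (at t) \<and> (\<lambda>y. \<phi> t y + \<theta> t y) differentiable (at x)" for t x
    using t x unfolding real_differentiable_def by blast
  ultimately show ?case
    using Suc.prems by (auto simp: case_prod_beta intro!: continuous_on_add Suc.IH)
qed

lemma continuous_on_mult_shift: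
  fixes \<psi> \<eta> \<gamma> :: "real \<Rightarrow> real"
  assumes "continuous_on UNIV \<psi>" "continuous_on UNIV \<eta>" "continuous_on UNIV \<gamma>"
  shows "continuous_on UNIV (\<lambda>(t, x). \<psi> t * \<eta> (x - \<gamma> t))"
  unfolding case_prod_beta
  by (intro continuous_on_mult continuous_on_compose2[OF assms(1)] continuous_on_compose2[OF assms(2)]
      continuous_on_diff continuous_on_compose2[OF assms(3)] continuous_intros) auto

text \<open>For a fixed curve, sums of moving products are closed under both partial derivatives:
  \<open>Dx\<close> acts on \<eta>, and \<open>Dt\<close> gives one product with \<psi>' and one
  with -\<psi> \<gamma>' as time factor. Hence the induction keeps \<gamma> and varies \<psi> and
  \<eta>.\<close>

lemma Ck_mult_shift:
  assumes "smooth \<psi>" "smooth \<eta>" "smooth \<gamma>"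
  shows "Ck k (\<lambda>t x. \<psi> t * \<eta> (x - \<gamma> t))"
  using assms
proof (induction k arbitrary: \<psi> \<eta>)
  case 0
  then show ?case by (auto intro!: continuous_on_mult_shift smooth_continuous_on)
next
  case (Suc k)
  have "smooth (\<lambda>t. - (\<psi> t * deriv \<gamma> t))"
    using smooth_cmult[OF smooth_mult[OF Suc.prems(1) smooth_deriv[OF Suc.prems(3)]], of "-1"] by simp
  then have "Ck k (Dt (\<lambda>t x. \<psi> t * \<eta> (x - \<gamma> t)))"
    unfolding Dt_mult_shift[OF Suc.prems] using Suc.prems
    by (intro Ck_add Suc.IH smooth_deriv)
  moreover have "Ck k (Dx (\<lambda>t x. \<psi> t * \<eta> (x - \<gamma> t)))"
    using funpow_Dx_mult_shift[OF Suc.prems(2), of 1 \<psi> \<gamma>] Suc.IH[OF Suc.prems(1) smooth_deriv[OF Suc.prems(2)] Suc.prems(3)]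
    by simp
  moreover have "continuous_on UNIV (\<lambda>(t, x). \<psi> t * \<eta> (x - \<gamma> t))"
    using Suc.prems by (intro continuous_on_mult_shift smooth_continuous_on)
  moreover have "(\<lambda>r. \<psi> r * \<eta> (x - \<gamma> r)) differentiable (at t) \<and>
      (\<lambda>y. \<psi> t * \<eta> (y - \<gamma> t)) differentiable (at x)" for t x
    using DERIV_mult_shift[OF Suc.prems] unfolding real_differentiable_def by blast
  ultimately show ?case by simp
qed

text \<open>On the compact interval {p..q} the curve is bounded by some M, so the moving support
  stays in the rectangle {p..q} x {-(r + M)..r + M}, which lies inside the open strip.\<close>

lemma test_function_mult_shift:
  assumes \<psi>: "smooth_supp p q \<psi>" and \<eta>: "smooth_supp (- r) r \<eta>" and \<gamma>: "smooth \<gamma>"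
    and pq: "0 < p" "q < T"
  shows "test_function (interior ({0..T} \<times> UNIV)) (\<lambda>t x. \<psi> t * \<eta> (x - \<gamma> t))"
proof -
  have "compact (\<gamma> ` {p..q})" by (intro compact_continuous_image smooth_continuous_on \<gamma>) auto
  then obtain M where M: "\<And>t. t \<in> {p..q} \<Longrightarrow> \<bar>\<gamma> t\<bar> \<le> M"
    by (meson bounded_real compact_imp_bounded imageI)
  let ?K = "{p..q} \<times> {- (r + M)..r + M}"
  have K: "compact ?K" by (intro compact_Times compact_Icc)
  have sub: "{(t, x). \<psi> t * \<eta> (x - \<gamma> t) \<noteq> 0} \<subseteq> ?K"
  proof safe
    fix t x assume nz: "\<psi> t * \<eta> (x - \<gamma> t) \<noteq> 0"
    then show t: "t \<in> {p..q}" using \<psi> by (auto simp: smooth_supp_def)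
    have "x - \<gamma> t \<in> {- r..r}" using nz \<eta> by (auto simp: smooth_supp_def)
    then show "x \<in> {- (r + M)..r + M}" using M[OF t] by auto
  qed
  then have cl: "closure {(t, x). \<psi> t * \<eta> (x - \<gamma> t) \<noteq> 0} \<subseteq> ?K"
    using K by (intro closure_minimal compact_imp_closed)
  have "?K \<subseteq> interior ({0..T} \<times> UNIV)"
    using pq by (auto simp: interior_Times)
  moreover have "compact (closure {(t, x). \<psi> t * \<eta> (x - \<gamma> t) \<noteq> 0})"
    using K sub by (meson bounded_subset compact_closure compact_imp_bounded)
  ultimately show ?thesis
    unfolding test_function_def using cl \<psi> \<eta> \<gamma> by (auto simp: smooth_supp_def intro!: Ck_mult_shift)
qed

lemma opL_Dt_mult_shift:
  assumes "smooth \<psi>" "smooth \<eta>" "smooth \<gamma>"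
  shows "opL \<alpha> \<beta> (Dt (\<lambda>t x. \<psi> t * \<eta> (x - \<gamma> t))) t x =
    deriv \<psi> t * rosenau \<alpha> \<beta> \<eta> (x - \<gamma> t) - \<psi> t * deriv \<gamma> t * rosenau \<alpha> \<beta> (deriv \<eta>) (x - \<gamma> t)"
  unfolding opL_def Dt_mult_shift[OF assms] rosenau_def
    funpow_Dx_add_mult_shift[OF assms(2) smooth_deriv[OF assms(2)]]
  by (simp add: algebra_simps)

text \<open>The derivative is approximated by a polynomial and the result is integrated from the
  exact value at 0, which bounds both errors together.\<close>

lemma polynomial_C1_approximation:
  fixes \<gamma> \<gamma>' :: "real \<Rightarrow> real"
  assumes \<gamma>: "\<And>t. (\<gamma> has_real_derivative \<gamma>' t) (at t)" "continuous_on UNIV \<gamma>'" and e: "e > 0" and T: "T > 0"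
  obtains g where "smooth g" "\<And>t. t \<in> {0..T} \<Longrightarrow> \<bar>g t - \<gamma> t\<bar> \<le> e"
    "\<And>t. t \<in> {0..T} \<Longrightarrow> \<bar>deriv g t - \<gamma>' t\<bar> \<le> e"
proof -
  \<comment> \<open>Integration over a time of length at most T multiplies the error by at most T,
    so the derivative must be met within e and within e / T.\<close>
  define d where "d = min e (e / T)"
  have d: "d > 0" "d \<le> e" "d * T \<le> e" using e T by (auto simp: d_def min_def field_simps)
  obtain P where P: "real_polynomial_function P" "\<And>t. t \<in> {0..T} \<Longrightarrow> \<bar>\<gamma>' t - P t\<bar> < d"
    using Stone_Weierstrass_real_polynomial_function[OF compact_Icc continuous_on_subset[OF \<gamma>(2)] d(1)]
    by (metis subset_UNIV)
  obtain Q where Q: "real_polynomial_function Q" "Q 0 = 0" "\<And>t. (Q has_real_derivative P t) (at t)"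
    using real_polynomial_function_antiderivative[OF P(1)] by blast
  define g where "g t = \<gamma> 0 + Q t" for t
  have g': "(g has_real_derivative P t) (at t)" for t
    unfolding g_def[abs_def] using DERIV_add[OF DERIV_const Q(3)] by simp
  have "smooth g"
    unfolding g_def[abs_def] by (intro smooth_add smooth_const smooth_real_polynomial_function Q)
  moreover have "\<bar>deriv g t - \<gamma>' t\<bar> \<le> e" if "t \<in> {0..T}" for t
    using P(2)[OF that] d DERIV_imp_deriv[OF g'[of t]] by auto
  moreover have "\<bar>g t - \<gamma> t\<bar> \<le> e" if t: "t \<in> {0..T}" for t
  proof -
    have "norm ((g t - \<gamma> t) - (g 0 - \<gamma> 0)) \<le> d * norm (t - 0)"
    proof (rule field_differentiable_bound[of "{0..T}" _ "\<lambda>t. P t - \<gamma>' t"])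
      show "((\<lambda>t. g t - \<gamma> t) has_real_derivative P z - \<gamma>' z) (at z within {0..T})" for z
        by (intro DERIV_diff has_field_derivative_at_within[OF g'] has_field_derivative_at_within[OF \<gamma>(1)])
      show "norm (P z - \<gamma>' z) \<le> d" if "z \<in> {0..T}" for z using P(2)[OF that] by auto
    qed (use t T in auto)
    also have "\<dots> \<le> d * T" using t d by (auto intro!: mult_left_mono)
    finally show ?thesis using d Q(2) by (simp add: g_def)
  qed
  ultimately show ?thesis using that by blast
qed

section \<open>Integrals along a curve\<close>

text \<open>Every term of the weak formulation has this shape, with n = 1 or n = m + 1, so one
  convergence argument serves them all.\<close>

definition plane_integral :: "(real \<Rightarrow> real \<Rightarrow> real) \<Rightarrow> nat \<Rightarrow> (real \<Rightarrow> real) \<Rightarrow> (real \<Rightarrow> real) \<Rightarrow> (real \<Rightarrow> real) \<Rightarrow> real" where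
  "plane_integral V n \<phi> P \<gamma> = (LINT z|lborel. V (fst z) (snd z) ^ n * (\<phi> (fst z) * P (snd z - \<gamma> (fst z))))"

locale locally_integrable_power =
  fixes V :: "real \<Rightarrow> real \<Rightarrow> real" and m :: nat and T :: real
  assumes meas: "(\<lambda>z. V (fst z) (snd z)) \<in> borel_measurable borel"
    and loc: "\<And>K. compact K \<Longrightarrow> K \<subseteq> {0<..<T} \<times> UNIV \<Longrightarrow>
      set_integrable lborel K (\<lambda>z. V (fst z) (snd z) ^ (m + 1))"
begin

text \<open>Since s \<le> 1 + s^(m+1) for s \<ge> 0, local integrability of the top power controls
  the first power as well. The result is a common majorant for both exponents.\<close>

lemma integrable_envelope:
  assumes "0 < p" "q < T"
  shows "integrable lborel (\<lambda>z. indicator ({p..q} \<times> {- M..M}) z *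
    (\<bar>V (fst z) (snd z)\<bar> + \<bar>V (fst z) (snd z)\<bar> ^ (m + 1)))"
proof -
  let ?K = "{p..q} \<times> {- M..M}"
  have cK: "compact ?K" by (intro compact_Times compact_Icc)
  have K: "?K \<subseteq> {0<..<T} \<times> UNIV" using assms by auto
  have [measurable]: "?K \<in> sets borel" by (intro borel_compact cK)
  note [measurable] = meas
  have "integrable lborel (indicator ?K :: real \<times> real \<Rightarrow> real)"
    using emeasure_bounded_finite[OF compact_imp_bounded[OF cK]] by (intro integrable_real_indicator) auto
  moreover have "integrable lborel (\<lambda>z. \<bar>indicator ?K z *\<^sub>R V (fst z) (snd z) ^ (m + 1)\<bar>)"
    using loc[OF cK K] by (intro integrable_abs) (simp add: set_integrable_def)
  ultimately have "integrable lborel (\<lambda>z. indicator ?K z + 2 * \<bar>indicator ?K z *\<^sub>R V (fst z) (snd z) ^ (m + 1)\<bar>)"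
    by (intro Bochner_Integration.integrable_add integrable_mult_right)
  then show ?thesis
  proof (rule Bochner_Integration.integrable_bound)
    show "AE z in lborel. norm (indicator ?K z * (\<bar>V (fst z) (snd z)\<bar> + \<bar>V (fst z) (snd z)\<bar> ^ (m + 1)))
        \<le> norm (indicator ?K z + 2 * \<bar>indicator ?K z *\<^sub>R V (fst z) (snd z) ^ (m + 1)\<bar>)"
    proof (intro AE_I2)
      fix z
      have "s \<le> 1 + s ^ (m + 1)" if "0 \<le> s" for s :: real
      proof (cases "s \<le> 1")
        case False
        then have "s ^ 1 \<le> s ^ (m + 1)" by (intro power_increasing) auto
        then show ?thesis by simp
      qed (use that in \<open>simp add: add_increasing2\<close>)
      from this[of "\<bar>V (fst z) (snd z)\<bar>"]
      show "norm (indicator ?K z * (\<bar>V (fst z) (snd z)\<bar> + \<bar>V (fst z) (snd z)\<bar> ^ (m + 1)))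
        \<le> norm (indicator ?K z + 2 * \<bar>indicator ?K z *\<^sub>R V (fst z) (snd z) ^ (m + 1)\<bar>)"
        by (cases "z \<in> ?K") (simp_all add: power_abs abs_mult)
    qed
  qed measurable
qed

text \<open>Weight and curve vary together. The uniform bound B on the curves confines all moving
  supports to one rectangle, where a multiple of the envelope dominates; this single bound yields
  integrability and dominated convergence.\<close>

lemma
  assumes pq: "0 < p" "q < T" and n: "n \<in> {1, m + 1}" and P: "smooth_supp (- r) r P"
    and \<phi>k: "\<And>k. continuous_on UNIV (\<phi>k k)" "\<And>k t. \<bar>\<phi>k k t\<bar> \<le> C * indicator {p..q} t"
    and \<gamma>k: "\<And>k. continuous_on UNIV (\<gamma>k k)" "\<And>k t. t \<in> {p..q} \<Longrightarrow> \<bar>\<gamma>k k t\<bar> \<le> B"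
    and \<phi>: "continuous_on UNIV \<phi>" "\<And>t. (\<lambda>k. \<phi>k k t) \<longlonglongrightarrow> \<phi> t"
    and \<gamma>: "continuous_on UNIV \<gamma>" "\<And>t. t \<in> {p..q} \<Longrightarrow> (\<lambda>k. \<gamma>k k t) \<longlonglongrightarrow> \<gamma> t"
  shows plane_integral_tendsto: "(\<lambda>k. plane_integral V n (\<phi>k k) P (\<gamma>k k)) \<longlonglongrightarrow> plane_integral V n \<phi> P \<gamma>"
    and plane_integrable: "integrable lborel (\<lambda>z. V (fst z) (snd z) ^ n * (\<phi>k k (fst z) * P (snd z - \<gamma>k k (fst z))))"
proof -
  note [measurable] = meas
  obtain D where D: "D \<ge> 0" "\<And>x. \<bar>P x\<bar> \<le> D" using smooth_supp_bounded[OF P] by blast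
  have cP: "continuous_on UNIV P" using P by (intro smooth_continuous_on) (simp add: smooth_supp_def)
  have pm: "(\<lambda>z. f (fst z) * P (snd z - g (fst z))) \<in> borel_measurable borel"
    if "continuous_on UNIV f" "continuous_on UNIV g" for f g :: "real \<Rightarrow> real"
    using continuous_on_mult_shift[OF that(1) cP that(2)] unfolding case_prod_beta
    by (rule borel_measurable_continuous_onI)
  note [measurable] = pm[OF \<phi>k(1) \<gamma>k(1)] pm[OF \<phi>(1) \<gamma>(1)]
  let ?w = "\<lambda>z. (C * D) * (indicator ({p..q} \<times> {- (r + B)..r + B}) z *
    (\<bar>V (fst z) (snd z)\<bar> + \<bar>V (fst z) (snd z)\<bar> ^ (m + 1)))"
  have w: "integrable lborel ?w"
    by (intro integrable_mult_right integrable_envelope pq)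
  have bound: "norm (V (fst z) (snd z) ^ n * (\<phi>k k (fst z) * P (snd z - \<gamma>k k (fst z)))) \<le> ?w z" for k z
  proof (cases "z \<in> {p..q} \<times> {- (r + B)..r + B}")
    case True
    have C: "\<bar>\<phi>k k (fst z)\<bar> \<le> C" using \<phi>k(2)[of k "fst z"] True by auto
    then have "\<bar>\<phi>k k (fst z)\<bar> * \<bar>P (snd z - \<gamma>k k (fst z))\<bar> \<le> C * D"
      using D by (intro mult_mono) auto
    moreover have "\<bar>V (fst z) (snd z) ^ n\<bar> \<le> \<bar>V (fst z) (snd z)\<bar> + \<bar>V (fst z) (snd z)\<bar> ^ (m + 1)"
      using n by (auto simp: power_abs abs_mult)
    ultimately have "\<bar>V (fst z) (snd z) ^ n\<bar> * (\<bar>\<phi>k k (fst z)\<bar> * \<bar>P (snd z - \<gamma>k k (fst z))\<bar>) \<le>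
        (\<bar>V (fst z) (snd z)\<bar> + \<bar>V (fst z) (snd z)\<bar> ^ (m + 1)) * (C * D)"
      by - (rule mult_mono, auto)
    then show ?thesis using True by (simp add: abs_mult mult_ac)
  next
    case False
    have "\<phi>k k (fst z) * P (snd z - \<gamma>k k (fst z)) = 0"
    proof (cases "fst z \<in> {p..q}")
      case True
      then have "snd z - \<gamma>k k (fst z) \<notin> {- r..r}"
        using False \<gamma>k(2)[OF True, of k] by (cases z) auto
      then show ?thesis using P by (simp add: smooth_supp_def)
    next
      case False
      then show ?thesis using \<phi>k(2)[of k "fst z"] by simp
    qed
    then show ?thesis using False by simp
  qed
  show "integrable lborel (\<lambda>z. V (fst z) (snd z) ^ n * (\<phi>k k (fst z) * P (snd z - \<gamma>k k (fst z))))"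
    by (rule Bochner_Integration.integrable_bound[OF w])
       (measurable, use bound in \<open>auto intro!: AE_I2 intro: order_trans[OF _ abs_ge_self]\<close>)
  show "(\<lambda>k. plane_integral V n (\<phi>k k) P (\<gamma>k k)) \<longlonglongrightarrow> plane_integral V n \<phi> P \<gamma>"
    unfolding plane_integral_def
  proof (rule integral_dominated_convergence[OF _ _ w])
    show "AE z in lborel. (\<lambda>k. V (fst z) (snd z) ^ n * (\<phi>k k (fst z) * P (snd z - \<gamma>k k (fst z))))
        \<longlonglongrightarrow> V (fst z) (snd z) ^ n * (\<phi> (fst z) * P (snd z - \<gamma> (fst z)))"
    proof (intro AE_I2 tendsto_mult_left)
      fix z :: "real \<times> real"
      show "(\<lambda>k. \<phi>k k (fst z) * P (snd z - \<gamma>k k (fst z))) \<longlonglongrightarrow> \<phi> (fst z) * P (snd z - \<gamma> (fst z))"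
      proof (cases "fst z \<in> {p..q}")
        case True
        have "isCont P (snd z - \<gamma> (fst z))" using cP by (simp add: continuous_on_eq_continuous_at)
        then show ?thesis
          by (intro tendsto_mult \<phi>(2) isCont_tendsto_compose[where g = P] tendsto_diff tendsto_const \<gamma>(2)[OF True])
      next
        \<comment> \<open>The curves are controlled on {p..q} only; elsewhere all weights vanish,
          and so does their limit.\<close>
        case False
        then have "\<phi>k k (fst z) = 0" for k using \<phi>k(2)[of k "fst z"] by simp
        moreover from this have "\<phi> (fst z) = 0" using \<phi>(2)[of "fst z"] by (simp add: LIMSEQ_const_iff)
        ultimately show ?thesis by simp
      qed
    qed
  qed (use bound in \<open>auto intro!: AE_I2\<close>, measurable)
qed

lemma plane_integrable_const:
  assumes "0 < p" "q < T" "n \<in> {1, m + 1}" "smooth_supp (- r) r P"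
    and \<phi>: "continuous_on UNIV \<phi>" "\<And>t. t \<notin> {p..q} \<Longrightarrow> \<phi> t = 0" and \<gamma>: "continuous_on UNIV \<gamma>"
  shows "integrable lborel (\<lambda>z. V (fst z) (snd z) ^ n * (\<phi> (fst z) * P (snd z - \<gamma> (fst z))))"
proof -
  have bdd: "\<exists>C. \<forall>t\<in>{p..q}. \<bar>f t\<bar> \<le> C" if "continuous_on UNIV f" for f :: "real \<Rightarrow> real"
    using compact_imp_bounded[OF compact_continuous_image[OF continuous_on_subset[OF that subset_UNIV] compact_Icc]]
    by (auto simp: bounded_real)
  obtain C B where C: "\<forall>t\<in>{p..q}. \<bar>\<phi> t\<bar> \<le> C" and B: "\<forall>t\<in>{p..q}. \<bar>\<gamma> t\<bar> \<le> B"
    using bdd[OF \<phi>(1)] bdd[OF \<gamma>] by blast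
  have "\<bar>\<phi> t\<bar> \<le> C * indicator {p..q} t" for t
    using C \<phi>(2) by (cases "t \<in> {p..q}") auto
  then show ?thesis
    using B assms by (intro plane_integrable[where \<phi>k = "\<lambda>_. \<phi>" and \<gamma>k = "\<lambda>_. \<gamma>" and \<phi> = \<phi> and \<gamma> = \<gamma>]) auto
qed

lemma plane_integral_iterated:
  assumes "0 < p" "q < T" "n \<in> {1, m + 1}" "smooth_supp (- r) r P"
    and "continuous_on UNIV \<phi>" "\<And>t. t \<notin> {p..q} \<Longrightarrow> \<phi> t = 0" "continuous_on UNIV \<gamma>"
  shows "plane_integral V n \<phi> P \<gamma> = (LINT t|lborel. \<phi> t * (LINT x|lborel. V t x ^ n * P (x - \<gamma> t)))"
proof -
  have i: "integrable (lborel \<Otimes>\<^sub>M lborel) (\<lambda>z. V (fst z) (snd z) ^ n * (\<phi> (fst z) * P (snd z - \<gamma> (fst z))))"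
    unfolding lborel_prod by (rule plane_integrable_const[OF assms])
  have "plane_integral V n \<phi> P \<gamma> =
      (LINT t|lborel. (LINT x|lborel. V t x ^ n * (\<phi> t * P (x - \<gamma> t))))"
    unfolding plane_integral_def using lborel_pair.integral_fst'[OF i] by (simp add: lborel_prod)
  also have "\<dots> = (LINT t|lborel. \<phi> t * (LINT x|lborel. V t x ^ n * P (x - \<gamma> t)))"
    by (simp add: mult.left_commute flip: integral_mult_right_zero)
  finally show ?thesis .
qed

end

section \<open>The weak formulation along a curve of class \<open>C\<^sup>1\<close>\<close>

text \<open>Gathers the linear terms free of time derivatives. All have odd order in x, so they
  reverse parity.\<close>

definition linear_flux :: "real \<Rightarrow> real \<Rightarrow> real \<Rightarrow> (real \<Rightarrow> real) \<Rightarrow> real \<Rightarrow> real" where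
  "linear_flux a \<kappa> \<mu> \<eta> x = a * deriv \<eta> x + \<kappa> * (deriv ^^ 3) \<eta> x - \<mu> * (deriv ^^ 5) \<eta> x"

lemma smooth_supp_linear_flux:
  assumes "smooth_supp p q \<eta>"
  shows "smooth_supp p q (linear_flux a \<kappa> \<mu> \<eta>)"
proof -
  have "smooth_supp p q (\<lambda>x. 0)" by (simp add: smooth_supp_def smooth_const)
  then have "smooth_supp p q (\<lambda>x. ((0 + a * (deriv ^^ 1) \<eta> x) + \<kappa> * (deriv ^^ 3) \<eta> x) + (- \<mu>) * (deriv ^^ 5) \<eta> x)"
    by (intro smooth_supp_add_cmult smooth_supp_funpow_deriv assms)
  then show ?thesis by (simp add: linear_flux_def[abs_def])
qed

text \<open>The cut-off in time is there because joint measurability of v is assumed on {0..T} x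
  UNIV only.\<close>

lemma weak_solution_locally_integrable_power:
  assumes "weak_solution a b \<kappa> \<alpha> \<beta> \<mu> m {0..T} v"
  shows "locally_integrable_power (\<lambda>t x. indicator {0..T} t * v t x) m T"
proof
  have "(\<lambda>z. indicator ({0..T} \<times> UNIV) z *\<^sub>R (case z of (t, x) \<Rightarrow> v t x)) \<in> borel_measurable borel"
    using assms by (simp add: weak_solution_def set_borel_measurable_def)
  moreover have "(\<lambda>z. indicator ({0..T} \<times> UNIV) z *\<^sub>R (case z of (t, x) \<Rightarrow> v t x)) =
      (\<lambda>z. indicator {0..T} (fst z) * v (fst z) (snd z))"
    by (auto simp: indicator_def)
  ultimately show "(\<lambda>z. indicator {0..T} (fst z) * v (fst z) (snd z)) \<in> borel_measurable borel" by simp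
next
  fix K :: "(real \<times> real) set"
  assume K: "compact K" "K \<subseteq> {0<..<T} \<times> UNIV"
  then have "K \<subseteq> interior ({0..T} \<times> UNIV)" by (simp add: interior_Times)
  then have "set_integrable lborel K (\<lambda>(t, x). v t x ^ (m + 1))"
    using assms K(1) by (simp add: weak_solution_def locally_integrable_on_def)
  moreover have "(\<lambda>z. indicator K z *\<^sub>R (case z of (t, x) \<Rightarrow> v t x ^ (m + 1))) =
      (\<lambda>z. indicator K z *\<^sub>R (indicator {0..T} (fst z) * v (fst z) (snd z)) ^ (m + 1))"
    using K(2) by (auto simp: indicator_def fun_eq_iff)
  ultimately show "set_integrable lborel K (\<lambda>z. (indicator {0..T} (fst z) * v (fst z) (snd z)) ^ (m + 1))"
    unfolding set_integrable_def by simp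
qed

text \<open>The time derivative of the moving product splits into a term with \<psi>' and the
  transport term -\<psi> \<gamma>' \<eta>', which later brings in the speed of the axis.\<close>

lemma weak_identity_smooth:
  assumes w: "weak_solution a b \<kappa> \<alpha> \<beta> \<mu> m {0..T} v"
    and pq: "0 < p" "q < T" and \<psi>: "smooth_supp p q \<psi>" and \<eta>: "smooth_supp (- r) r \<eta>" and \<gamma>: "smooth \<gamma>"
  defines "V \<equiv> \<lambda>t x. indicator {0..T} t * v t x"
  shows "plane_integral V 1 (deriv \<psi>) (rosenau \<alpha> \<beta> \<eta>) \<gamma>
    - plane_integral V 1 (\<lambda>t. \<psi> t * deriv \<gamma> t) (rosenau \<alpha> \<beta> (deriv \<eta>)) \<gamma>
    + plane_integral V 1 \<psi> (linear_flux a \<kappa> \<mu> \<eta>) \<gamma>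
    + b / (real m + 1) * plane_integral V (m + 1) \<psi> (deriv \<eta>) \<gamma> = 0"
proof -
  interpret locally_integrable_power V m T
    unfolding V_def by (rule weak_solution_locally_integrable_power[OF w])
  have s: "smooth \<psi>" "smooth \<eta>" using \<psi> \<eta> by (auto simp: smooth_supp_def)
  let ?\<phi> = "\<lambda>t x. \<psi> t * \<eta> (x - \<gamma> t)"
  define f1 where "f1 z = V (fst z) (snd z) ^ 1 * (deriv \<psi> (fst z) * rosenau \<alpha> \<beta> \<eta> (snd z - \<gamma> (fst z)))" for z
  define f2 where "f2 z = V (fst z) (snd z) ^ 1 * (\<psi> (fst z) * deriv \<gamma> (fst z) * rosenau \<alpha> \<beta> (deriv \<eta>) (snd z - \<gamma> (fst z)))" for z
  define f3 where "f3 z = V (fst z) (snd z) ^ 1 * (\<psi> (fst z) * linear_flux a \<kappa> \<mu> \<eta> (snd z - \<gamma> (fst z)))" for z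
  define f4 where "f4 z = V (fst z) (snd z) ^ (m + 1) * (\<psi> (fst z) * deriv \<eta> (snd z - \<gamma> (fst z)))" for z
  have z: "\<psi> t = 0" "deriv \<psi> t = 0" if "t \<notin> {p..q}" for t
    using \<psi> smooth_supp_deriv[OF \<psi>] that by (auto simp: smooth_supp_def)
  have c: "continuous_on UNIV \<psi>" "continuous_on UNIV (deriv \<psi>)" "continuous_on UNIV \<gamma>" "continuous_on UNIV (deriv \<gamma>)"
    by (intro smooth_continuous_on smooth_deriv s \<gamma>)+
  have i: "integrable lborel f1" "integrable lborel f2" "integrable lborel f3" "integrable lborel f4"
    unfolding f1_def f2_def f3_def f4_def
    using plane_integrable_const[OF pq _ smooth_supp_rosenau[OF \<eta>] c(2) z(2) c(3), of 1]
      plane_integrable_const[OF pq _ smooth_supp_rosenau[OF smooth_supp_deriv[OF \<eta>]]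
        continuous_on_mult[OF c(1) c(4)] _ c(3), of 1]
      plane_integrable_const[OF pq _ smooth_supp_linear_flux[OF \<eta>] c(1) z(1) c(3), of 1]
      plane_integrable_const[OF pq _ smooth_supp_deriv[OF \<eta>] c(1) z(1) c(3), of "m + 1"]
    by (simp_all add: z)
  have tf: "test_function (interior ({0..T} \<times> UNIV)) ?\<phi>"
    by (rule test_function_mult_shift[OF \<psi> \<eta> \<gamma> pq])
  have "0 = set_lebesgue_integral lborel ({0..T} \<times> UNIV)
          (\<lambda>(t, x). v t x * opL \<alpha> \<beta> (Dt ?\<phi>) t x
             + (a * v t x + b / (real m + 1) * v t x ^ (m + 1)) * Dx ?\<phi> t x
             + \<kappa> * v t x * (Dx ^^ 3) ?\<phi> t x
             - \<mu> * v t x * (Dx ^^ 5) ?\<phi> t x)"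
    by (rule w[unfolded weak_solution_def, THEN conjunct2, THEN conjunct2, THEN conjunct2,
          rule_format, OF tf, symmetric])
  also have "\<dots> = (LINT z|lborel. f1 z - f2 z + f3 z + b / (real m + 1) * f4 z)"
    unfolding set_lebesgue_integral_def
  proof (rule Bochner_Integration.integral_cong[OF refl])
    fix z :: "real \<times> real"
    obtain t x where [simp]: "z = (t, x)" by (cases z)
    have D: "Dx ?\<phi> t x = \<psi> t * deriv \<eta> (x - \<gamma> t)"
      using funpow_Dx_mult_shift[OF s(2), of 1 \<psi> \<gamma>] by simp
    show "indicator ({0..T} \<times> UNIV) z *\<^sub>R (case z of (t, x) \<Rightarrow> v t x * opL \<alpha> \<beta> (Dt ?\<phi>) t x
             + (a * v t x + b / (real m + 1) * v t x ^ (m + 1)) * Dx ?\<phi> t x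
             + \<kappa> * v t x * (Dx ^^ 3) ?\<phi> t x
             - \<mu> * v t x * (Dx ^^ 5) ?\<phi> t x) = f1 z - f2 z + f3 z + b / (real m + 1) * f4 z"
    proof (cases "t \<in> {0..T}")
      case True
      then show ?thesis
        unfolding opL_Dt_mult_shift[OF s \<gamma>] funpow_Dx_mult_shift[OF s(2)] f1_def f2_def f3_def f4_def
        by (simp add: D V_def linear_flux_def) (simp add: algebra_simps add_divide_distrib)
    next
      case False
      then show ?thesis by (simp add: f1_def f2_def f3_def f4_def V_def)
    qed
  qed
  also have "\<dots> = (LINT z|lborel. f1 z) - (LINT z|lborel. f2 z) + (LINT z|lborel. f3 z)
      + b / (real m + 1) * (LINT z|lborel. f4 z)"
    using i by (simp only: Bochner_Integration.integral_add Bochner_Integration.integral_diff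
        integral_mult_right_zero integrable_mult_right Bochner_Integration.integrable_diff
        Bochner_Integration.integrable_add)
  finally show ?thesis
    unfolding plane_integral_def f1_def f2_def f3_def f4_def by simp
qed

text \<open>For a curve that is only C1 the moving product is no longer admissible, but both sides
  of the smooth identity are continuous with respect to uniform convergence of \<gamma> and
  \<gamma>' on {0..T}.\<close>

lemma weak_identity_C1:
  assumes w: "weak_solution a b \<kappa> \<alpha> \<beta> \<mu> m {0..T} v" and T: "T > 0"
    and pq: "0 < p" "q < T" and \<psi>: "smooth_supp p q \<psi>" and \<eta>: "smooth_supp (- r) r \<eta>"
    and \<gamma>: "\<And>t. (\<gamma> has_real_derivative \<gamma>' t) (at t)" "continuous_on UNIV \<gamma>'"
  defines "V \<equiv> \<lambda>t x. indicator {0..T} t * v t x"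
  shows "plane_integral V 1 (deriv \<psi>) (rosenau \<alpha> \<beta> \<eta>) \<gamma>
    - plane_integral V 1 (\<lambda>t. \<psi> t * \<gamma>' t) (rosenau \<alpha> \<beta> (deriv \<eta>)) \<gamma>
    + plane_integral V 1 \<psi> (linear_flux a \<kappa> \<mu> \<eta>) \<gamma>
    + b / (real m + 1) * plane_integral V (m + 1) \<psi> (deriv \<eta>) \<gamma> = 0"
proof -
  interpret locally_integrable_power V m T
    unfolding V_def by (rule weak_solution_locally_integrable_power[OF w])
  have s: "smooth \<psi>" using \<psi> by (auto simp: smooth_supp_def)
  have c: "continuous_on UNIV \<psi>" "continuous_on UNIV (deriv \<psi>)"
    by (intro smooth_continuous_on smooth_deriv s)+
  have c\<gamma>: "continuous_on UNIV \<gamma>"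
    using \<gamma>(1) by (meson DERIV_isCont continuous_at_imp_continuous_on)
  have z: "\<psi> t = 0" "deriv \<psi> t = 0" if "t \<notin> {p..q}" for t
    using \<psi> smooth_supp_deriv[OF \<psi>] that by (auto simp: smooth_supp_def)
  have "\<exists>g. smooth g \<and> (\<forall>t\<in>{0..T}. \<bar>g t - \<gamma> t\<bar> \<le> 1 / real (Suc k) \<and> \<bar>deriv g t - \<gamma>' t\<bar> \<le> 1 / real (Suc k))" for k
    using polynomial_C1_approximation[OF \<gamma> _ T, of "1 / real (Suc k)"] by (metis of_nat_0_less_iff zero_less_Suc zero_less_divide_1_iff)
  then obtain g where g: "\<And>k. smooth (g k)"
    "\<And>k t. t \<in> {0..T} \<Longrightarrow> \<bar>g k t - \<gamma> t\<bar> \<le> 1 / real (Suc k)"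
    "\<And>k t. t \<in> {0..T} \<Longrightarrow> \<bar>deriv (g k) t - \<gamma>' t\<bar> \<le> 1 / real (Suc k)"
    by metis
  have lim: "(\<lambda>k. h k) \<longlonglongrightarrow> l" if "\<And>k. \<bar>h k - l\<bar> \<le> 1 / real (Suc k)" for h l
  proof -
    have "(\<lambda>k. h k - l) \<longlonglongrightarrow> 0"
      by (rule Lim_null_comparison[OF _ LIMSEQ_inverse_real_of_nat])
         (use that in \<open>simp add: inverse_eq_divide\<close>)
    then show ?thesis by (rule LIM_zero_cancel)
  qed
  have bdd: "\<exists>C\<ge>0. \<forall>t\<in>{0..T}. \<bar>f t\<bar> \<le> C" if "continuous_on UNIV f" for f :: "real \<Rightarrow> real"
  proof -
    have "bounded (f ` {0..T})"
      by (intro compact_imp_bounded compact_continuous_image continuous_on_subset[OF that]) auto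
    then obtain C where "\<forall>t\<in>{0..T}. \<bar>f t\<bar> \<le> C" by (auto simp: bounded_real)
    then show ?thesis using T by (intro exI[of _ C]) (auto intro: order_trans[OF abs_ge_zero, of "f 0"])
  qed
  obtain B where B: "\<forall>t\<in>{0..T}. \<bar>\<gamma> t\<bar> \<le> B" using bdd[OF c\<gamma>] by blast
  obtain B' where B': "B' \<ge> 0" "\<forall>t\<in>{0..T}. \<bar>\<gamma>' t\<bar> \<le> B'" using bdd[OF \<gamma>(2)] by blast
  obtain C where C: "C \<ge> 0" "\<forall>t\<in>{0..T}. \<bar>\<psi> t\<bar> \<le> C" using bdd[OF c(1)] by blast
  obtain C' where C': "C' \<ge> 0" "\<forall>t\<in>{0..T}. \<bar>deriv \<psi> t\<bar> \<le> C'" using bdd[OF c(2)] by blast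
  have le1: "1 / real (Suc k) \<le> 1" for k by simp
  have sub: "t \<in> {0..T}" if "t \<in> {p..q}" for t using that pq by auto
  have gB: "\<bar>g k t\<bar> \<le> B + 1" if "t \<in> {p..q}" for k t
    using g(2)[OF sub[OF that], of k] bspec[OF B sub[OF that]] le1[of k] by linarith
  have gB': "\<bar>deriv (g k) t\<bar> \<le> B' + 1" if "t \<in> {p..q}" for k t
    using g(3)[OF sub[OF that], of k] bspec[OF B'(2) sub[OF that]] le1[of k] by linarith
  have gl: "(\<lambda>k. g k t) \<longlonglongrightarrow> \<gamma> t" if "t \<in> {p..q}" for t
    by (rule lim) (rule g(2)[OF sub[OF that]])
  have gl': "(\<lambda>k. deriv (g k) t) \<longlonglongrightarrow> \<gamma>' t" if "t \<in> {p..q}" for t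
    by (rule lim) (rule g(3)[OF sub[OF that]])
  have b1: "\<bar>deriv \<psi> t\<bar> \<le> C' * indicator {p..q} t" and b2: "\<bar>\<psi> t\<bar> \<le> C * indicator {p..q} t" for t
    using C C' sub z by (cases "t \<in> {p..q}"; force)+
  \<comment> \<open>The transport weight is the one that changes with k; here convergence of the
    derivatives of the curves enters.\<close>
  have b3: "\<bar>\<psi> t * deriv (g k) t\<bar> \<le> (C * (B' + 1)) * indicator {p..q} t" for k t
  proof (cases "t \<in> {p..q}")
    case True
    then show ?thesis using C sub[OF True] gB'[OF True, of k] B' by (auto simp: abs_mult intro!: mult_mono)
  qed (simp add: z)
  have l3: "(\<lambda>k. \<psi> t * deriv (g k) t) \<longlonglongrightarrow> \<psi> t * \<gamma>' t" for t
    using gl'[of t] z(1)[of t] by (cases "t \<in> {p..q}") (auto intro!: tendsto_mult_left)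
  have cg: "continuous_on UNIV (g k)" "continuous_on UNIV (deriv (g k))" for k
    by (intro smooth_continuous_on smooth_deriv g)+
  note lims = plane_integral_tendsto[OF pq _ _ _ _ _ _ _ _ c\<gamma> gl]
  have "(\<lambda>k. plane_integral V 1 (deriv \<psi>) (rosenau \<alpha> \<beta> \<eta>) (g k)
      - plane_integral V 1 (\<lambda>t. \<psi> t * deriv (g k) t) (rosenau \<alpha> \<beta> (deriv \<eta>)) (g k)
      + plane_integral V 1 \<psi> (linear_flux a \<kappa> \<mu> \<eta>) (g k)
      + b / (real m + 1) * plane_integral V (m + 1) \<psi> (deriv \<eta>) (g k)) \<longlonglongrightarrow>
     plane_integral V 1 (deriv \<psi>) (rosenau \<alpha> \<beta> \<eta>) \<gamma>
    - plane_integral V 1 (\<lambda>t. \<psi> t * \<gamma>' t) (rosenau \<alpha> \<beta> (deriv \<eta>)) \<gamma>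
    + plane_integral V 1 \<psi> (linear_flux a \<kappa> \<mu> \<eta>) \<gamma>
    + b / (real m + 1) * plane_integral V (m + 1) \<psi> (deriv \<eta>) \<gamma>"
  proof (intro tendsto_add tendsto_diff tendsto_mult_left)
    show "(\<lambda>k. plane_integral V 1 (deriv \<psi>) (rosenau \<alpha> \<beta> \<eta>) (g k)) \<longlonglongrightarrow>
        plane_integral V 1 (deriv \<psi>) (rosenau \<alpha> \<beta> \<eta>) \<gamma>"
      by (rule lims[where \<phi>k = "\<lambda>_. deriv \<psi>"])
         (auto intro!: smooth_supp_rosenau \<eta> c cg gB b1)
    show "(\<lambda>k. plane_integral V 1 (\<lambda>t. \<psi> t * deriv (g k) t) (rosenau \<alpha> \<beta> (deriv \<eta>)) (g k)) \<longlonglongrightarrow>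
        plane_integral V 1 (\<lambda>t. \<psi> t * \<gamma>' t) (rosenau \<alpha> \<beta> (deriv \<eta>)) \<gamma>"
      by (rule lims)
         (auto intro!: smooth_supp_rosenau smooth_supp_deriv \<eta> c cg gB b3 l3 \<gamma>(2) continuous_on_mult)
    show "(\<lambda>k. plane_integral V 1 \<psi> (linear_flux a \<kappa> \<mu> \<eta>) (g k)) \<longlonglongrightarrow>
        plane_integral V 1 \<psi> (linear_flux a \<kappa> \<mu> \<eta>) \<gamma>"
      by (rule lims[where \<phi>k = "\<lambda>_. \<psi>"])
         (auto intro!: smooth_supp_linear_flux \<eta> c cg gB b2)
    show "(\<lambda>k. plane_integral V (m + 1) \<psi> (deriv \<eta>) (g k)) \<longlonglongrightarrow>
        plane_integral V (m + 1) \<psi> (deriv \<eta>) \<gamma>"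
      by (rule lims[where \<phi>k = "\<lambda>_. \<psi>"])
         (auto intro!: smooth_supp_deriv \<eta> c cg gB b2)
  qed
  then show ?thesis
    using weak_identity_smooth[OF w pq \<psi> \<eta> g(1)] by (simp add: V_def LIMSEQ_const_iff)
qed

text \<open>Iterated integrals are the form in which symmetry of v, a property of each single slice,
  can be applied.\<close>

lemma weak_identity:
  assumes w: "weak_solution a b \<kappa> \<alpha> \<beta> \<mu> m {0..T} v" and T: "T > 0"
    and pq: "0 < p" "q < T" and \<psi>: "smooth_supp p q \<psi>" and \<eta>: "smooth_supp (- r) r \<eta>"
    and \<gamma>: "\<And>t. (\<gamma> has_real_derivative \<gamma>' t) (at t)" "continuous_on UNIV \<gamma>'"
  shows "(LINT t|lborel. deriv \<psi> t * (LINT x|lborel. v t x * rosenau \<alpha> \<beta> \<eta> (x - \<gamma> t)))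
    - (LINT t|lborel. \<psi> t * \<gamma>' t * (LINT x|lborel. v t x * rosenau \<alpha> \<beta> (deriv \<eta>) (x - \<gamma> t)))
    + (LINT t|lborel. \<psi> t * (LINT x|lborel. v t x * linear_flux a \<kappa> \<mu> \<eta> (x - \<gamma> t)))
    + b / (real m + 1) * (LINT t|lborel. \<psi> t * (LINT x|lborel. v t x ^ (m + 1) * deriv \<eta> (x - \<gamma> t))) = 0"
proof -
  let ?V = "\<lambda>t x. indicator {0..T} t * v t x"
  interpret locally_integrable_power ?V m T
    by (rule weak_solution_locally_integrable_power[OF w])
  have s: "smooth \<psi>" using \<psi> by (auto simp: smooth_supp_def)
  have c: "continuous_on UNIV \<psi>" "continuous_on UNIV (deriv \<psi>)"
    by (intro smooth_continuous_on smooth_deriv s)+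
  have c\<gamma>: "continuous_on UNIV \<gamma>"
    using \<gamma>(1) by (meson DERIV_isCont continuous_at_imp_continuous_on)
  have z: "\<psi> t = 0" "deriv \<psi> t = 0" if "t \<notin> {p..q}" for t
    using \<psi> smooth_supp_deriv[OF \<psi>] that by (auto simp: smooth_supp_def)
  have it: "plane_integral ?V n \<phi> P \<gamma> = (LINT t|lborel. \<phi> t * (LINT x|lborel. v t x ^ n * P (x - \<gamma> t)))"
    if "n \<in> {1, m + 1}" "smooth_supp (- r) r P" "continuous_on UNIV \<phi>" "\<And>t. t \<notin> {p..q} \<Longrightarrow> \<phi> t = 0" for n P \<phi>
  proof -
    have "plane_integral ?V n \<phi> P \<gamma> = (LINT t|lborel. \<phi> t * (LINT x|lborel. ?V t x ^ n * P (x - \<gamma> t)))"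
      by (rule plane_integral_iterated[OF pq that(1,2,3) _ c\<gamma>]) (rule that(4))
    also have "\<dots> = (LINT t|lborel. \<phi> t * (LINT x|lborel. v t x ^ n * P (x - \<gamma> t)))"
    proof (intro Bochner_Integration.integral_cong refl)
      show "\<phi> t * (LINT x|lborel. ?V t x ^ n * P (x - \<gamma> t)) =
          \<phi> t * (LINT x|lborel. v t x ^ n * P (x - \<gamma> t))" for t
        using that(4)[of t] pq by (cases "t \<in> {p..q}") auto
    qed
    finally show ?thesis .
  qed
  show ?thesis
    using weak_identity_C1[OF w T pq \<psi> \<eta> \<gamma>]
      it[of 1 "rosenau \<alpha> \<beta> \<eta>" "deriv \<psi>"] it[of 1 "rosenau \<alpha> \<beta> (deriv \<eta>)" "\<lambda>t. \<psi> t * \<gamma>' t"]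
      it[of 1 "linear_flux a \<kappa> \<mu> \<eta>" \<psi>] it[of "m + 1" "deriv \<eta>" \<psi>]
    by (simp add: smooth_supp_rosenau smooth_supp_deriv smooth_supp_linear_flux \<eta> c \<gamma>(2) z continuous_on_mult)
qed

section \<open>Continuous functions of time and parity\<close>

text \<open>Test functions reach any compact part of the open interval; the endpoints follow by
  continuity.\<close>

lemma fundamental_lemma_continuous:
  assumes h: "continuous_on {0..T} h" and T: "T > 0"
    and zero: "\<And>p q \<psi>. 0 < p \<Longrightarrow> q < T \<Longrightarrow> smooth_supp p q \<psi> \<Longrightarrow> (LINT t|lborel. \<psi> t * h t) = 0"
    and t: "t \<in> {0..T}"
  shows "h t = (0::real)"
proof -
  have "h s = 0" if s: "s \<in> {0<..<T}" for s
  proof -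
    \<comment> \<open>Half the distance from s to the boundary keeps the closed window inside the
      open interval.\<close>
    define d where "d = min s (T - s) / 2"
    have d: "0 < s - d" "s + d < T" "s - d < s + d" using s by (auto simp: d_def min_def field_simps)
    have c: "continuous_on {s - d..s + d} h" using d by (intro continuous_on_subset[OF h]) auto
    have "AE x in lborel. x \<in> {s - d..s + d} \<longrightarrow> h x = 0"
    proof (rule fundamental_lemma_interval)
      show "set_integrable lborel {s - d..s + d} h" by (rule borel_integrable_atLeastAtMost'[OF c])
      show "(LINT x|lborel. h x * \<psi> x) = 0" if "smooth_supp (s - d) (s + d) \<psi>" for \<psi>
        using zero[OF d(1,2) that] by (simp add: mult.commute)
    qed
    from continuous_AE_zero[OF c d(3) this] show ?thesis using d by auto
  qed
  moreover have "closure {0<..<T} = {0..T}" using T by (rule closure_greaterThanLessThan)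
  ultimately show ?thesis
    using continuous_constant_on_closure[of "{0<..<T}" h 0 t] h t by auto
qed

text \<open>A test function near t1 is slid to t2. The derivative of its pairing with h with respect
  to the shift is minus a pairing of h with a differentiated test function, hence 0. So h(x + t2 -
  t1) - h(x) is orthogonal to every test function near t1, and h takes the same value at t1 and
  t2.\<close>

lemma du_Bois_Reymond:
  assumes h: "continuous_on {0..T} h" and T: "T > 0"
    and zero: "\<And>p q \<psi>. 0 < p \<Longrightarrow> q < T \<Longrightarrow> smooth_supp p q \<psi> \<Longrightarrow> (LINT t|lborel. deriv \<psi> t * h t) = 0"
    and t: "t \<in> {0..T}" "t' \<in> {0..T}"
  shows "h t = (h t' :: real)"
proof -
  \<comment> \<open>Extension by 0 gives an L2 function on the line, to which the results on
    \<open>corr\<close> apply.\<close>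
  define f where "f t = indicator {0..T} t *\<^sub>R h t" for t
  have i: "integrable lborel f"
    unfolding f_def[abs_def] by (intro borel_integrable_compact h compact_Icc)
  have "integrable lborel (\<lambda>t. indicator {0..T} t *\<^sub>R (h t)\<^sup>2)"
    by (intro borel_integrable_compact continuous_on_power h compact_Icc)
  moreover have "(\<lambda>t. indicator {0..T} t *\<^sub>R (h t)\<^sup>2) = (\<lambda>t. (norm (f t))\<^sup>2)"
    by (auto simp: f_def indicator_def)
  ultimately have f: "L2 f" using i by (simp add: L2_def)
  have le: "h t1 = h t2" if t12: "0 < t1" "t1 < t2" "t2 < T" for t1 t2
  proof -
    \<comment> \<open>With this margin the window around t1 stays in the open interval during the
      whole slide to t2.\<close>
    define d where "d = min t1 (T - t2) / 2"
    define s where "s = t2 - t1"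
    have d: "0 < t1 - d" "t2 + d < T" "t1 - d < t1 + d" using t12 by (auto simp: d_def min_def field_simps)
    let ?J = "{t1 - d..t1 + d}"
    have c: "continuous_on ?J (\<lambda>x. h (x + s) - h x)"
      using d t12 by (intro continuous_on_diff continuous_on_compose2[OF h] continuous_on_subset[OF h] continuous_intros)
        (auto simp: s_def)
    have "AE x in lborel. x \<in> ?J \<longrightarrow> h (x + s) - h x = 0"
    proof (rule fundamental_lemma_interval)
      show "set_integrable lborel ?J (\<lambda>x. h (x + s) - h x)" by (rule borel_integrable_atLeastAtMost'[OF c])
    next
      fix \<psi> assume \<psi>: "smooth_supp (t1 - d) (t1 + d) \<psi>"
      have s\<psi>: "smooth \<psi>" using \<psi> by (simp add: smooth_supp_def)
      have D: "(corr f \<psi> has_real_derivative 0) (at y)" if y: "y \<in> {0..s}" for y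
      proof -
        have sh: "smooth_supp (t1 - d + y) (t1 + d + y) (\<lambda>x. \<psi> (x - y))" by (rule smooth_supp_shift[OF \<psi>])
        have pq: "0 < t1 - d + y" "t1 + d + y < T" using d y by (auto simp: s_def)
        have "corr f (deriv \<psi>) y = (LINT x|lborel. deriv (\<lambda>x. \<psi> (x - y)) x * h x)"
          unfolding corr_def
        proof (intro Bochner_Integration.integral_cong refl)
          fix x
          have e: "deriv (\<lambda>x. \<psi> (x - y)) x = deriv \<psi> (x - y)"
            using funpow_deriv_shift[OF s\<psi>, of 1 y] by (simp add: fun_eq_iff)
          show "f x * deriv \<psi> (x - y) = deriv (\<lambda>x. \<psi> (x - y)) x * h x"
          proof (cases "x \<in> {0..T}")
            case False
            then have "x - y \<notin> {t1 - d..t1 + d}" using pq by auto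
            then show ?thesis using smooth_supp_deriv[OF \<psi>] by (simp add: e smooth_supp_def)
          qed (simp add: e f_def)
        qed
        also have "\<dots> = 0" by (rule zero[OF pq sh])
        finally show ?thesis using corr_has_derivative[OF f \<psi>, of y] by simp
      qed
      have "\<exists>c. \<forall>y\<in>{0..s}. corr f \<psi> y = c"
        using D by (intro has_field_derivative_zero_constant) (auto intro: has_field_derivative_at_within)
      then have "corr f \<psi> s = corr f \<psi> 0" using t12 by (auto simp: s_def)
      then have e: "(LINT x|lborel. f x * \<psi> (x - s)) = (LINT x|lborel. f x * \<psi> x)"
        by (simp add: corr_def)
      have "(LINT x|lborel. f x * \<psi> (x - s)) = (LINT x|lborel. f (x + s) * \<psi> x)"
        using lborel_integral_real_affine[of 1 "\<lambda>x. f x * \<psi> (x - s)" s] by (simp add: add.commute)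
      moreover have "integrable lborel (\<lambda>x. f x * \<psi> x)"
        by (intro L2_mult_integrable f smooth_supp_L2[OF \<psi>])
      moreover have "integrable lborel (\<lambda>x. f x * \<psi> (x - s))"
        by (intro L2_mult_integrable f smooth_supp_L2[OF smooth_supp_shift[OF \<psi>]])
      then have "integrable lborel (\<lambda>x. f (x + s) * \<psi> x)"
        using lborel_integrable_real_affine[of "\<lambda>x. f x * \<psi> (x - s)" 1 s] by (simp add: add.commute)
      ultimately have "(LINT x|lborel. f (x + s) * \<psi> x - f x * \<psi> x) = 0"
        using e by simp
      moreover have "(h (x + s) - h x) * \<psi> x = f (x + s) * \<psi> x - f x * \<psi> x" for x
      proof (cases "x \<in> ?J")
        case True
        then have "x \<in> {0..T}" "x + s \<in> {0..T}" using d t12 by (auto simp: s_def)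
        then show ?thesis by (simp add: f_def algebra_simps)
      next
        case False
        then show ?thesis using \<psi> by (simp add: smooth_supp_def)
      qed
      ultimately show "(LINT x|lborel. (h (x + s) - h x) * \<psi> x) = 0" by simp
    qed
    from continuous_AE_zero[OF c d(3) this, of t1] show ?thesis using d by (simp add: s_def)
  qed
  have eq: "h t1 = h t2" if "t1 \<in> {0<..<T}" "t2 \<in> {0<..<T}" for t1 t2
    using le[of t1 t2] le[of t2 t1] that by (cases t1 t2 rule: linorder_cases) auto
  have cl: "closure {0<..<T} = {0..T}" using T by (rule closure_greaterThanLessThan)
  have "h x = h (T / 2)" if x: "x \<in> {0..T}" for x
  proof (rule continuous_constant_on_closure[of "{0<..<T}" h])
    show "h y = h (T / 2)" if "y \<in> {0<..<T}" for y
      using T that by (intro eq) auto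
  qed (use h x in \<open>simp_all only: cl\<close>)
  from this[OF t(1)] this[OF t(2)] show ?thesis by simp
qed

section \<open>Translations and continuity of pairings along the axis\<close>

lemma L2_diff:
  fixes f g :: "real \<Rightarrow> real"
  assumes "L2 f" "L2 g"
  shows "L2 (\<lambda>x. f x - g x)"
proof -
  have [measurable]: "f \<in> borel_measurable borel" "g \<in> borel_measurable borel"
    and i: "integrable lborel (\<lambda>x. (f x)\<^sup>2)" "integrable lborel (\<lambda>x. (g x)\<^sup>2)"
    using assms by (auto simp: L2_def)
  have "integrable lborel (\<lambda>x. ((f x)\<^sup>2 + (g x)\<^sup>2) - 2 * (f x * g x))"
    using i L2_mult_integrable[OF assms] by simp
  then show ?thesis by (simp add: L2_def power2_diff mult.assoc)
qed

lemma L2_shift: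
  fixes f :: "real \<Rightarrow> real"
  assumes "L2 f"
  shows "L2 (\<lambda>x. f (x + y))"
  using assms lborel_integrable_real_affine[of "\<lambda>x. (norm (f x))\<^sup>2" 1 y]
  by (auto simp: L2_def add.commute)

lemma L2_norm_shift:
  fixes f :: "real \<Rightarrow> real"
  shows "L2_norm (\<lambda>x. f (x - y)) = L2_norm f"
  unfolding L2_norm_def
  using lborel_integral_real_affine[of 1 "\<lambda>x. (norm (f x))\<^sup>2" "- y"] by simp

lemma corr_eq_shifted: "corr f P y = (LINT x|lborel. f (x + y) * P x)"
  unfolding corr_def using lborel_integral_real_affine[of 1 "\<lambda>x. f x * P (x - y)" y]
  by (simp add: add.commute)

text \<open>The change of v at a fixed translate is bounded by Cauchy-Schwarz, uniformly in the
  translate because the L2 norm is invariant under shifts. The change of the translate at a fixed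
  time is covered by differentiability of \<open>corr\<close>.\<close>

lemma continuous_on_corr_axis:
  assumes v: "in_C_L2 I v" and \<gamma>: "continuous_on UNIV \<gamma>" and P: "smooth_supp p q P"
  shows "continuous_on I (\<lambda>t. corr (v t) P (\<gamma> t))"
  unfolding continuous_on_def
proof
  fix s assume s: "s \<in> I"
  have vL: "L2 (v t)" if "t \<in> I" for t using v that by (simp add: in_C_L2_def)
  have "((\<lambda>t. L2_norm (\<lambda>x. v t x - v s x) * L2_norm P) \<longlongrightarrow> 0) (at s within I)"
    using v s by (intro tendsto_mult_left_zero) (simp add: in_C_L2_def)
  then have "((\<lambda>t. corr (v t) P (\<gamma> t) - corr (v s) P (\<gamma> t)) \<longlongrightarrow> 0) (at s within I)"
  proof (rule Lim_null_comparison[rotated])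
    show "\<forall>\<^sub>F t in at s within I. norm (corr (v t) P (\<gamma> t) - corr (v s) P (\<gamma> t))
        \<le> L2_norm (\<lambda>x. v t x - v s x) * L2_norm P"
      unfolding eventually_at_filter
    proof (intro always_eventually allI impI)
      fix t assume t: "t \<in> I"
      have P': "L2 (\<lambda>x. P (x - \<gamma> t))" by (rule smooth_supp_L2[OF smooth_supp_shift[OF P]])
      have "corr (v t) P (\<gamma> t) - corr (v s) P (\<gamma> t) = (LINT x|lborel. (v t x - v s x) * P (x - \<gamma> t))"
        unfolding corr_def left_diff_distrib
        by (rule Bochner_Integration.integral_diff[symmetric]) (intro L2_mult_integrable vL s t P')+
      also have "\<bar>\<dots>\<bar> \<le> L2_norm (\<lambda>x. v t x - v s x) * L2_norm (\<lambda>x. P (x - \<gamma> t))"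
        by (intro L2_Cauchy_Schwarz L2_diff vL s t P')
      finally show "norm (corr (v t) P (\<gamma> t) - corr (v s) P (\<gamma> t)) \<le> L2_norm (\<lambda>x. v t x - v s x) * L2_norm P"
        by (simp add: L2_norm_shift)
    qed
  qed
  moreover have "((\<lambda>t. corr (v s) P (\<gamma> t)) \<longlongrightarrow> corr (v s) P (\<gamma> s)) (at s within I)"
    using \<gamma> DERIV_isCont[OF corr_has_derivative[OF vL[OF s] P]]
    by (intro isCont_tendsto_compose[where g = "corr (v s) P"])
       (auto simp: continuous_on_def intro: tendsto_within_subset)
  ultimately have "((\<lambda>t. (corr (v t) P (\<gamma> t) - corr (v s) P (\<gamma> t)) + corr (v s) P (\<gamma> t)) \<longlongrightarrow> 0 + corr (v s) P (\<gamma> s)) (at s within I)"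
    by (rule tendsto_add)
  then show "((\<lambda>t. corr (v t) P (\<gamma> t)) \<longlongrightarrow> corr (v s) P (\<gamma> s)) (at s within I)" by simp
qed

section \<open>Parity of derivatives and reflection of integrals\<close>

lemma funpow_deriv_parity:
  assumes g: "smooth g" and par: "\<And>x. g (- x) = c * g x"
  shows "(deriv ^^ k) g (- x) = c * (- 1) ^ k * (deriv ^^ k) g x"
proof (induction k arbitrary: x)
  case (Suc k)
  let ?f = "(deriv ^^ k) g"
  have D: "(?f has_real_derivative deriv ?f y) (at y)" for y
    by (intro smooth_DERIV smooth_funpow_deriv g)
  have "((\<lambda>x. ?f (- x)) has_real_derivative deriv ?f (- x) * (- 1)) (at x)"
    by (rule DERIV_chain2[OF D]) (auto intro!: derivative_eq_intros)
  moreover have "((\<lambda>x. ?f (- x)) has_real_derivative (c * (- 1) ^ k) * deriv ?f x) (at x)"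
    unfolding Suc.IH by (intro DERIV_cmult D)
  ultimately have "deriv ?f (- x) * (- 1) = (c * (- 1) ^ k) * deriv ?f x" by (rule DERIV_unique)
  then show ?case by simp
qed (simp add: par)

text \<open>With c = 1 and c = -1 both parities are handled at once: L keeps the parity, while d/dx,
  L d/dx and the flux reverse it.\<close>

lemma parity_operators:
  assumes g: "smooth g" and par: "\<And>x. g (- x) = c * g x"
  shows "rosenau \<alpha> \<beta> g (- x) = c * rosenau \<alpha> \<beta> g x"
    and "rosenau \<alpha> \<beta> (deriv g) (- x) = - c * rosenau \<alpha> \<beta> (deriv g) x"
    and "linear_flux a \<kappa> \<mu> g (- x) = - c * linear_flux a \<kappa> \<mu> g x"
    and "deriv g (- x) = - c * deriv g x"
proof -
  note P = funpow_deriv_parity[OF g par]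
  show "rosenau \<alpha> \<beta> g (- x) = c * rosenau \<alpha> \<beta> g x"
    unfolding rosenau_def P par by (simp add: algebra_simps)
  show d: "deriv g (- x) = - c * deriv g x" for x
    using P[of 1] by simp
  show "linear_flux a \<kappa> \<mu> g (- x) = - c * linear_flux a \<kappa> \<mu> g x"
    unfolding linear_flux_def P d by (simp add: algebra_simps)
  show "rosenau \<alpha> \<beta> (deriv g) (- x) = - c * rosenau \<alpha> \<beta> (deriv g) x"
    unfolding rosenau_def funpow_deriv_parity[OF smooth_deriv[OF g] d] d by (simp add: algebra_simps)
qed

text \<open>Reflection about c followed by replacement almost everywhere. Both steps remain valid
  when the integral takes its default value 0, which matters for n = m + 1: single slices of v^(m+1)
  may fail to be locally integrable.\<close>

lemma symmetric_integral_reflect: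
  fixes w P :: "real \<Rightarrow> real"
  assumes [measurable]: "w \<in> borel_measurable borel" "P \<in> borel_measurable borel"
    and sym: "AE x in lborel. w x = w (2 * c - x)"
  shows "(LINT x|lborel. w x ^ n * P (x - c)) = (LINT x|lborel. w x ^ n * P (- (x - c)))"
proof -
  have "(LINT x|lborel. w x ^ n * P (x - c)) = (LINT x|lborel. w (2 * c - x) ^ n * P (- (x - c)))"
    using lborel_integral_real_affine[of "-1" "\<lambda>x. w x ^ n * P (x - c)" "2 * c"] by (simp add: algebra_simps)
  also have "\<dots> = (LINT x|lborel. w x ^ n * P (- (x - c)))"
    by (rule integral_cong_AE) (use sym in \<open>auto elim!: eventually_mono\<close>)
  finally show ?thesis .
qed

lemma symmetric_integral_odd:
  fixes w P :: "real \<Rightarrow> real"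
  assumes "w \<in> borel_measurable borel" "P \<in> borel_measurable borel"
    and "AE x in lborel. w x = w (2 * c - x)" and odd: "\<And>x. P (- x) = - P x"
  shows "(LINT x|lborel. w x ^ n * P (x - c)) = 0"
  using symmetric_integral_reflect[OF assms(1-3), of n] unfolding odd by simp

section \<open>Symmetric solutions\<close>

lemma funpow_deriv_add_reflect:
  assumes "smooth f"
  shows "(deriv ^^ k) (\<lambda>x. f x + c * f (- x)) x = (deriv ^^ k) f x + c * ((- 1) ^ k * (deriv ^^ k) f (- x))"
proof -
  have "smooth (\<lambda>x. f (- x))" using smooth_affine[OF assms, of "-1" 0] by simp
  from funpow_deriv_add_cmult[OF assms this, of k c] show ?thesis
    using funpow_deriv_affine[OF assms, of k "-1" 0] by simp
qed

lemma rosenau_deriv: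
  "rosenau \<alpha> \<beta> (deriv f) x = (deriv ^^ 1) f x - \<alpha> * (deriv ^^ 3) f x + \<beta> * (deriv ^^ 5) f x"
  by (simp add: rosenau_def eval_nat_numeral)

context
  fixes a b \<kappa> \<mu> \<alpha> \<beta> T :: real and m :: nat and v :: "real \<Rightarrow> real \<Rightarrow> real" and lam lam' :: "real \<Rightarrow> real"
  assumes ab: "\<alpha> \<ge> 0" "\<beta> \<ge> 0" and T: "T > 0"
    and w: "weak_solution a b \<kappa> \<alpha> \<beta> \<mu> m {0..T} v"
    and lam: "\<And>t. (lam has_real_derivative lam' t) (at t)" "continuous_on UNIV lam'"
    and sym: "\<And>t. t \<in> {0..T} \<Longrightarrow> AE x in lborel. v t x = v t (2 * lam t - x)"
begin

lemma weak_solution_L2: "t \<in> {0..T} \<Longrightarrow> L2 (v t)"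
  using w by (simp add: weak_solution_def in_C_L2_def)

lemma axis_odd_integral_zero:
  assumes "t \<in> {0..T}" "smooth_supp p q P" "\<And>x. P (- x) = - P x"
  shows "(LINT x|lborel. v t x ^ n * P (x - lam t)) = 0"
  using weak_solution_L2[OF assms(1)] sym[OF assms(1)] assms(2,3)
  by (intro symmetric_integral_odd) (auto simp: L2_def smooth_supp_def intro: smooth_borel_measurable)

text \<open>Testing with the even part of \<open>\<eta>\<close>, translated along the axis, removes every term of the
  weak formulation which carries an odd number of \<open>x\<close>-derivatives.\<close>

lemma axis_frame_rosenau_constant:
  assumes \<eta>: "smooth_supp (- r) r \<eta>" and t: "t \<in> {0..T}" "t' \<in> {0..T}"
  shows "corr (v t) (rosenau \<alpha> \<beta> \<eta>) (lam t) = corr (v t') (rosenau \<alpha> \<beta> \<eta>) (lam t')"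
proof -
  \<comment> \<open>Twice the even part of \<eta>.\<close>
  define e where "e x = \<eta> x + 1 * \<eta> (- x)" for x
  have e: "smooth_supp (- r) r e"
    unfolding e_def[abs_def] by (intro smooth_supp_add_cmult smooth_supp_reflect \<eta>)
  have se: "smooth e" and s\<eta>: "smooth \<eta>" using e \<eta> by (auto simp: smooth_supp_def)
  have par: "e (- x) = 1 * e x" for x by (simp add: e_def)
  note par' = parity_operators[OF se par]
  have clam: "continuous_on UNIV lam"
    using lam(1) by (meson DERIV_isCont continuous_at_imp_continuous_on)
  have vC: "in_C_L2 {0..T} v" using w by (simp add: weak_solution_def)
  define h where "h t = corr (v t) (rosenau \<alpha> \<beta> e) (lam t)" for t
  have "h t = h t'"
  proof (rule du_Bois_Reymond[OF _ T _ t])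
    show "continuous_on {0..T} h"
      unfolding h_def[abs_def] by (rule continuous_on_corr_axis[OF vC clam smooth_supp_rosenau[OF e]])
  next
    fix p q \<psi>
    assume pq: "0 < p" "q < T" and \<psi>: "smooth_supp p q \<psi>"
    have z: "\<psi> t * c t * (LINT x|lborel. v t x ^ n * P (x - lam t)) = 0"
      if "smooth_supp (- r) r P" "\<And>x. P (- x) = - 1 * P x" for t n P and c :: "real \<Rightarrow> real"
    proof (cases "t \<in> {0..T}")
      case True
      then show ?thesis using axis_odd_integral_zero[OF True that(1), of n] that(2) by simp
    next
      case False
      then show ?thesis using \<psi> pq by (auto simp: smooth_supp_def)
    qed
    have z2: "\<psi> t * lam' t * (LINT x|lborel. v t x * rosenau \<alpha> \<beta> (deriv e) (x - lam t)) = 0"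
      and z3: "\<psi> t * (LINT x|lborel. v t x * linear_flux a \<kappa> \<mu> e (x - lam t)) = 0"
      and z4: "\<psi> t * (LINT x|lborel. v t x ^ (m + 1) * deriv e (x - lam t)) = 0" for t
      using z[OF smooth_supp_rosenau[OF smooth_supp_deriv[OF e]] par'(2), of t lam' 1]
        z[OF smooth_supp_linear_flux[OF e] par'(3), of t "\<lambda>_. 1" 1]
        z[OF smooth_supp_deriv[OF e] par'(4), of t "\<lambda>_. 1" "m + 1"] by simp_all
    show "(LINT t|lborel. deriv \<psi> t * h t) = 0"
      using weak_identity[OF w T pq \<psi> e lam] unfolding z2 z3 z4
      by (simp add: h_def corr_def)
  qed
  \<comment> \<open>As \<open>v t\<close> is even about the axis, the reflected half contributes the
    same amount; passing to the even part therefore loses no information about \<eta>.\<close>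
  moreover have "h t = 2 * corr (v t) (rosenau \<alpha> \<beta> \<eta>) (lam t)" if t: "t \<in> {0..T}" for t
  proof -
    let ?R = "rosenau \<alpha> \<beta> \<eta>"
    have R: "smooth_supp (- r) r ?R" by (rule smooth_supp_rosenau[OF \<eta>])
    have Re: "rosenau \<alpha> \<beta> e x = ?R x + ?R (- x)" for x
      unfolding rosenau_def e_def[abs_def] funpow_deriv_add_reflect[OF s\<eta>] by (simp add: algebra_simps)
    have "corr (v t) ?R (lam t) = (LINT x|lborel. v t x * ?R (- (x - lam t)))"
      unfolding corr_def
      using symmetric_integral_reflect[OF _ _ sym[OF t], of ?R 1] weak_solution_L2[OF t] smooth_supp_smooth[OF R]
      by (simp add: L2_def smooth_borel_measurable)
    moreover have "h t = (LINT x|lborel. v t x * ?R (x - lam t) + v t x * ?R (- (x - lam t)))"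
      unfolding h_def corr_def Re by (simp add: distrib_left)
    moreover have "\<dots> = (LINT x|lborel. v t x * ?R (x - lam t)) + (LINT x|lborel. v t x * ?R (- (x - lam t)))"
      using smooth_supp_shift[OF R, of "lam t"] smooth_supp_shift[OF smooth_supp_reflect[OF R], of "lam t"]
      by (intro Bochner_Integration.integral_add L2_mult_integrable weak_solution_L2[OF t] smooth_supp_L2)
    ultimately show ?thesis by (simp add: corr_def)
  qed
  ultimately show ?thesis using t by simp
qed

text \<open>The difference of two slices seen from the axis is orthogonal to L \<rho> for every test
  function \<rho>, so injectivity applies. Any support is first enlarged to an interval symmetric
  about 0.\<close>

lemma axis_frame_stationary:
  assumes t: "t \<in> {0..T}" "t' \<in> {0..T}"
  shows "AE x in lborel. v t (x + lam t) = v t' (x + lam t')"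
proof -
  have L: "L2 (\<lambda>x. v s (x + lam s))" if "s \<in> {0..T}" for s by (rule L2_shift[OF weak_solution_L2[OF that]])
  have "AE x in lborel. v t (x + lam t) - v t' (x + lam t') = 0"
  proof (rule rosenau_injective[OF ab L2_diff[OF L[OF t(1)] L[OF t(2)]]])
    fix p q \<rho> assume "smooth_supp p q \<rho>"
    then have \<rho>: "smooth_supp (- max \<bar>p\<bar> \<bar>q\<bar>) (max \<bar>p\<bar> \<bar>q\<bar>) \<rho>"
      by (rule smooth_supp_mono) auto
    have i: "integrable lborel (\<lambda>x. v s (x + lam s) * rosenau \<alpha> \<beta> \<rho> x)" if "s \<in> {0..T}" for s
      by (intro L2_mult_integrable L that smooth_supp_L2[OF smooth_supp_rosenau[OF \<rho>]])
    show "(LINT x|lborel. (v t (x + lam t) - v t' (x + lam t')) * rosenau \<alpha> \<beta> \<rho> x) = 0"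
      using axis_frame_rosenau_constant[OF \<rho> t] i[OF t(1)] i[OF t(2)]
      by (simp add: corr_eq_shifted left_diff_distrib)
  qed
  then show ?thesis by simp
qed

text \<open>Testing with the odd part of \<open>\<eta>\<close> instead isolates the complementary terms, whose spatial
  integrals no longer depend on time.\<close>

lemma axis_speed_relation:
  assumes \<eta>: "smooth_supp (- r) r \<eta>" and t0: "t0 \<in> {0..T}"
  obtains N where "\<And>t. t \<in> {0..T} \<Longrightarrow>
    lam' t * (LINT x|lborel. v t0 (x + lam t0) * rosenau \<alpha> \<beta> (deriv \<eta>) x) = N"
proof -
  define od where "od x = \<eta> x + (- 1) * \<eta> (- x)" for x
  have od: "smooth_supp (- r) r od"
    unfolding od_def[abs_def] by (intro smooth_supp_add_cmult smooth_supp_reflect \<eta>)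
  have so: "smooth od" and s\<eta>: "smooth \<eta>" using od \<eta> by (auto simp: smooth_supp_def)
  have par: "od (- x) = - 1 * od x" for x by (simp add: od_def)
  note par' = parity_operators[OF so par]
  define V where "V x = v t0 (x + lam t0)" for x
  have Vm[measurable]: "V \<in> borel_measurable borel"
    using L2_shift[OF weak_solution_L2[OF t0], of "lam t0"] by (simp add: L2_def V_def[abs_def])
  \<comment> \<open>Seen from the axis, every slice equals V almost everywhere, so such integrals do
    not depend on t; this also covers powers that are not integrable, where both sides are
    0.\<close>
  have VI: "(LINT x|lborel. v t x ^ n * P (x - lam t)) = (LINT x|lborel. V x ^ n * P x)"
    if t: "t \<in> {0..T}" and P: "smooth_supp (- r) r P" for t n P
  proof -
    have [measurable]: "P \<in> borel_measurable borel" using P by (auto simp: smooth_supp_def intro: smooth_borel_measurable)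
    have [measurable]: "(\<lambda>x. v t (x + lam t)) \<in> borel_measurable borel"
      using L2_shift[OF weak_solution_L2[OF t], of "lam t"] by (simp add: L2_def)
    have "(LINT x|lborel. v t x ^ n * P (x - lam t)) = (LINT x|lborel. v t (x + lam t) ^ n * P x)"
      using lborel_integral_real_affine[of 1 "\<lambda>x. v t x ^ n * P (x - lam t)" "lam t"]
      by (simp add: add.commute)
    also have "\<dots> = (LINT x|lborel. V x ^ n * P x)"
    proof (rule integral_cong_AE)
      show "AE x in lborel. v t (x + lam t) ^ n * P x = V x ^ n * P x"
        using axis_frame_stationary[OF t t0] by eventually_elim (simp add: V_def)
    qed auto
    finally show ?thesis .
  qed
  define A where "A = (LINT x|lborel. V x * rosenau \<alpha> \<beta> (deriv od) x)"
  define N where "N = (LINT x|lborel. V x * linear_flux a \<kappa> \<mu> od x)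
    + b / (real m + 1) * (LINT x|lborel. V x ^ (m + 1) * deriv od x)"
  \<comment> \<open>N and A do not depend on t, so the weak identity says that the continuous
    function N - lam' A is orthogonal to every \<psi>.\<close>
  have rel: "N - lam' t * A = 0" if t: "t \<in> {0..T}" for t
  proof (rule fundamental_lemma_continuous[OF _ T _ t])
    show "continuous_on {0..T} (\<lambda>t. N - lam' t * A)"
      by (intro continuous_intros continuous_on_subset[OF lam(2)]) auto
  next
    fix p q \<psi>
    assume pq: "0 < p" "q < T" and \<psi>: "smooth_supp p q \<psi>"
    have z0: "\<psi> t = 0" "deriv \<psi> t = 0" if "t \<notin> {0..T}" for t
      using \<psi> smooth_supp_deriv[OF \<psi>] pq that by (auto simp: smooth_supp_def)
    \<comment> \<open>L keeps \<open>od\<close> odd while \<open>v t\<close> is even about the axis: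
      now the term with \<psi>' is the one that drops out.\<close>
    have e1: "deriv \<psi> t * (LINT x|lborel. v t x * rosenau \<alpha> \<beta> od (x - lam t)) = 0" for t
      using axis_odd_integral_zero[OF _ smooth_supp_rosenau[OF od], where t = t and n = 1] par'(1) z0 by (cases "t \<in> {0..T}") auto
    have e2: "\<psi> t * lam' t * (LINT x|lborel. v t x * rosenau \<alpha> \<beta> (deriv od) (x - lam t)) = (\<psi> t * lam' t) * A"
      and e3: "\<psi> t * (LINT x|lborel. v t x * linear_flux a \<kappa> \<mu> od (x - lam t)) =
        \<psi> t * (LINT x|lborel. V x * linear_flux a \<kappa> \<mu> od x)"
      and e4: "\<psi> t * (LINT x|lborel. v t x ^ (m + 1) * deriv od (x - lam t)) =
        \<psi> t * (LINT x|lborel. V x ^ (m + 1) * deriv od x)" for t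
      using VI[OF _ smooth_supp_rosenau[OF smooth_supp_deriv[OF od]], where t = t and n = 1]
        VI[OF _ smooth_supp_linear_flux[OF od], where t = t and n = 1]
        VI[OF _ smooth_supp_deriv[OF od], where t = t and n = "m + 1"] z0
      by (cases "t \<in> {0..T}"; simp add: A_def)+
    have c: "continuous_on UNIV \<psi>" using \<psi> by (intro smooth_continuous_on) (simp add: smooth_supp_def)
    have i: "integrable lborel (\<lambda>t. \<psi> t * f t)" if "continuous_on UNIV f" for f
    proof -
      have "integrable lborel (\<lambda>t. indicator {0..T} t *\<^sub>R (\<psi> t * f t))"
        by (intro borel_integrable_compact continuous_on_subset[OF continuous_on_mult[OF c that]]) auto
      moreover have "(\<lambda>t. indicator {0..T} t *\<^sub>R (\<psi> t * f t)) = (\<lambda>t. \<psi> t * f t)"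
        using z0 by (auto simp: indicator_def fun_eq_iff)
      ultimately show ?thesis by simp
    qed
    have "(LINT t|lborel. \<psi> t * (N - lam' t * A)) = (LINT t|lborel. \<psi> t * 1 * N - \<psi> t * lam' t * A)"
      by (simp add: algebra_simps)
    also have "\<dots> = (LINT t|lborel. \<psi> t * 1) * N - (LINT t|lborel. \<psi> t * lam' t) * A"
      using i[of "\<lambda>_. 1"] i[OF lam(2)] by simp
    also have "\<dots> = 0"
      using weak_identity[OF w T pq \<psi> od lam] unfolding e1 e2 e3 e4
      by (simp add: N_def algebra_simps)
    finally show "(LINT t|lborel. \<psi> t * (N - lam' t * A)) = 0" .
  qed
  let ?R = "rosenau \<alpha> \<beta> (deriv \<eta>)"
  have R: "smooth_supp (- r) r ?R" by (intro smooth_supp_rosenau smooth_supp_deriv \<eta>)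
  \<comment> \<open>L d/dx reverses parity, so from the odd part it produces twice the even part of
    \<open>?R\<close>; against the even profile V this counts \<open>?R\<close> twice. The relation
    thus holds for arbitrary \<eta>, as injectivity of L d/dx requires, and the factor 2 turns N
    into N / 2.\<close>
  have Ro: "rosenau \<alpha> \<beta> (deriv od) x = ?R x + ?R (- x)" for x
    unfolding rosenau_deriv od_def[abs_def] funpow_deriv_add_reflect[OF s\<eta>] by (simp add: algebra_simps)
  have symV: "AE x in lborel. V x = V (2 * 0 - x)"
  proof -
    have [measurable]: "v t0 \<in> borel_measurable borel" using weak_solution_L2[OF t0] by (simp add: L2_def)
    have "Measurable.pred borel (\<lambda>x. v t0 x = v t0 (2 * lam t0 - x))" by measurable
    from AE_borel_affine[OF _ this sym[OF t0], of 1 "lam t0"]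
    show ?thesis by (auto simp: V_def algebra_simps elim!: eventually_mono)
  qed
  have VL: "L2 V" unfolding V_def[abs_def] by (rule L2_shift[OF weak_solution_L2[OF t0]])
  have "A = (LINT x|lborel. V x * ?R x + V x * ?R (- x))"
    unfolding A_def Ro by (simp add: distrib_left)
  also have "\<dots> = (LINT x|lborel. V x * ?R x) + (LINT x|lborel. V x * ?R (- x))"
    by (intro Bochner_Integration.integral_add L2_mult_integrable VL smooth_supp_L2[OF R]
        smooth_supp_L2[OF smooth_supp_reflect[OF R]])
  also have "(LINT x|lborel. V x * ?R (- x)) = (LINT x|lborel. V x * ?R x)"
    using symmetric_integral_reflect[OF Vm _ symV, of ?R 1] smooth_supp_smooth[OF R]
    by (simp add: smooth_borel_measurable)
  finally have A: "A = 2 * (LINT x|lborel. V x * ?R x)" by simp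
  show ?thesis
  proof (rule that[of "N / 2"])
    fix t assume "t \<in> {0..T}"
    then have "lam' t * A = N" using rel[of t] by simp
    then show "lam' t * (LINT x|lborel. v t0 (x + lam t0) * ?R x) = N / 2"
      unfolding A by (simp add: V_def)
  qed
qed

lemma symmetric_solution_steady:
  assumes t0: "t0 \<in> {0..T}"
  shows "steady {0..T} v (lam' t0)"
proof -
  define V where "V x = v t0 (x + lam t0)" for x
  have VL: "L2 V" unfolding V_def[abs_def] by (rule L2_shift[OF weak_solution_L2[OF t0]])
  have vV: "AE x in lborel. v t x = V (x - lam t)" if t: "t \<in> {0..T}" for t
  proof -
    have [measurable]: "(\<lambda>x. v t (x + lam t)) \<in> borel_measurable borel" "V \<in> borel_measurable borel"
      using L2_shift[OF weak_solution_L2[OF t], of "lam t"] VL by (simp_all add: L2_def)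
    have "Measurable.pred borel (\<lambda>x. v t (x + lam t) = V x)" by measurable
    moreover have "AE x in lborel. v t (x + lam t) = V x"
      using axis_frame_stationary[OF t t0] by (simp add: V_def)
    ultimately show ?thesis
      using AE_borel_affine[of 1 "\<lambda>x. v t (x + lam t) = V x" "- lam t"] by simp
  qed
  show ?thesis
  proof (cases "\<forall>p q \<rho>. smooth_supp p q \<rho> \<longrightarrow> (LINT x|lborel. V x * rosenau \<alpha> \<beta> (deriv \<rho>) x) = 0")
    case True
    \<comment> \<open>The zero profile travels with every speed, whatever the axis does.\<close>
    then have V0: "AE x in lborel. V x = 0" by (intro rosenau_deriv_injective[OF ab VL]) blast
    have [measurable]: "V \<in> borel_measurable borel" using VL by (simp add: L2_def)
    have "AE x in lborel. v t x = 0" if t: "t \<in> {0..T}" for t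
    proof -
      have "AE x in lborel. V (x - lam t) = 0"
        using AE_borel_affine[of 1 "\<lambda>x. V x = 0" "- lam t"] V0 by simp
      with vV[OF t] show ?thesis by eventually_elim simp
    qed
    then show ?thesis unfolding steady_def by (intro exI[of _ "\<lambda>_. 0"]) auto
  next
    case False
    then obtain p q \<rho> where "smooth_supp p q \<rho>"
      and nz: "(LINT x|lborel. V x * rosenau \<alpha> \<beta> (deriv \<rho>) x) \<noteq> 0" by blast
    then have \<rho>: "smooth_supp (- max \<bar>p\<bar> \<bar>q\<bar>) (max \<bar>p\<bar> \<bar>q\<bar>) \<rho>"
      by (auto intro: smooth_supp_mono)
    obtain N where N: "\<And>t. t \<in> {0..T} \<Longrightarrow>
        lam' t * (LINT x|lborel. V x * rosenau \<alpha> \<beta> (deriv \<rho>) x) = N"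
      using axis_speed_relation[OF \<rho> t0] unfolding V_def by blast
    have const: "lam' t = lam' t0" if "t \<in> {0..T}" for t
      using N[OF that] N[OF t0] nz by (metis mult_right_cancel)
    have lin: "lam t = lam t0 + lam' t0 * (t - t0)" if t: "t \<in> {0..T}" for t
    proof -
      have "\<exists>c. \<forall>s\<in>{0..T}. lam s - lam' t0 * s = c"
      proof (rule has_field_derivative_zero_constant)
        show "((\<lambda>s. lam s - lam' t0 * s) has_real_derivative 0) (at s within {0..T})" if "s \<in> {0..T}" for s
          using has_field_derivative_at_within[OF lam(1)[of s], of "{0..T}"] const[OF that]
          by (auto intro!: derivative_eq_intros)
      qed auto
      then show ?thesis using t t0 by (auto simp: algebra_simps)
    qed
    \<comment> \<open>The steady form x - c t carries no phase, so the constant c t0 - lam(t0), with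
      c = lam'(t0), is absorbed into the profile.\<close>
    have "AE x in lborel. v t x = V ((x - lam' t0 * t) + (lam' t0 * t0 - lam t0))" if t: "t \<in> {0..T}" for t
    proof -
      have "x - lam t = (x - lam' t0 * t) + (lam' t0 * t0 - lam t0)" for x
        using lin[OF t] by (simp add: algebra_simps)
      then show ?thesis using vV[OF t] by (simp only:)
    qed
    then show ?thesis
      unfolding steady_def by (intro exI[of _ "\<lambda>z. V (z + (lam' t0 * t0 - lam t0))"]) auto
  qed
qed

end

theorem theorem4p3:
  fixes a b \<kappa> \<mu> \<alpha> \<beta> T t0 :: real and m :: nat
    and v :: "real \<Rightarrow> real \<Rightarrow> real" and v0 lam :: "real \<Rightarrow> real"
  assumes "\<alpha> \<ge> 0" and "\<beta> \<ge> 0" and "m \<ge> 1"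
    and "T > 0" and "t0 \<in> {0..T}"
    and "weak_solution a b \<kappa> \<alpha> \<beta> \<mu> m {0..T} v"
    and "v0 = v t0"
    and "well_posed_for a b \<kappa> \<alpha> \<beta> \<mu> m {0..T} t0 v0 v"
    and "spatially_symmetric {0..T} v lam"
  shows "steady {0..T} v (deriv lam t0)"
proof -
  obtain D where D: "\<And>t. (lam has_vector_derivative D t) (at t)" "continuous_on UNIV D"
    using assms(9) by (auto simp: spatially_symmetric_def C1_differentiable_on_def)
  then have lam: "(lam has_real_derivative D t) (at t)" for t
    by (simp add: has_real_derivative_iff_has_vector_derivative)
  have "steady {0..T} v (D t0)"
    using assms(9)
    by (intro symmetric_solution_steady[OF assms(1,2,4,6) lam D(2) _ assms(5)])
       (simp add: spatially_symmetric_def)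
  then show ?thesis using DERIV_imp_deriv[OF lam] by simp
qed

end
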